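(* Let $X,Y$ be, conditionally on $\theta$, independent and distributed according to the Type II mixture model $$X\mid K,\theta\sim f_{\theta,K}\ \text{ with } K\sim g,\qquad Y\mid J,\theta\sim q_{\theta,J}\ \text{ with } J\sim h ,$$ and let $\theta$ have prior density $\pi$ on $\Theta$ with respect to a $\sigma$-finite measure $\tau$. Let $\pi_{k,x}$ and $g_{\pi,x}$ be, respectively, the conditional densities of $\theta$ given $(x,k)$ and of $k$ given $x$, given by $$\pi_{k,x}(\theta)=\frac{\pi(\theta)\,f_{\theta,k}(x)}{m_{\pi,k}(x)},\qquad g_{\pi,x}(k)=\frac{g(k)\,m_{\pi,k}(x)}{\int_{\mathcal K}g(k)\,m_{\pi,k}(x)\,d\mu(k)},\qquad \theta\in\Theta,\ x\in\mathbb R^d,\ k\in\mathcal K,$$ with $m_{\pi,k}(x)=\int_\Theta f_{\theta,k}(x)\,\pi(\theta)\,d\tau(\theta)$. Then: (a) The posterior distribution of $\theta$ given $X=x$ is the distribution of a random element $U$ admitting the mixture representation $$U\mid K'\sim\pi_{K',x},\qquad K'\sim g_{\pi,x};$$ that is, $\pi(\theta\mid x)=\int_{\mathcal K}\pi_{k',x}(\theta)\,g_{\pi,x}(k')\,d\mu(k')$. (b) The Bayes predictive density of $Y$ given $X=x$ admits the representation $$Y\mid J',K'\sim q_\pi(\cdot\mid J',K'),\qquad J'\sim h,\ K'\sim g_{\pi,x}\ \text{ independent},$$ with $$q_\pi(y\mid j',k')=\int_\Theta q_{\theta,j'}(y)\,\pi_{k',x}(\theta)\,d\tau(\theta);$$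 that is, $q_\pi(y\mid x)=\int_{\mathcal K}\int_{\mathcal K}q_\pi(y\mid j',k')\,g_{\pi,x}(k')\,h(j')\,d\mu(k')\,d\mu(j')$. An alternative equivalent representation is $$Y\mid J'\sim q'_{x,J'},\qquad J'\sim h,\qquad\text{with}\quad q'_{x,j'}(y)=\int_{\mathcal K}q_\pi(y\mid j',k')\,g_{\pi,x}(k')\,d\mu(k').$$
   Context: Setting: $X,Y$ take values in $\mathbb R^d$; the parameter $\theta$ lies in $\Theta\subseteq\mathbb R^p$; the mixing variables $K,J$ take values in a measurable space $\mathcal K$, and their distributions do not depend on $\theta$. For each $\theta\in\Theta$ and $k,j\in\mathcal K$, $f_{\theta,k}$ and $q_{\theta,j}$ are probability densities on $\mathbb R^d$ with respect to a $\sigma$-finite measure $\nu$, known except for the value of $\theta$; $g$ and $h$ are known probability densities on $\mathcal K$ with respect to a $\sigma$-finite measure $\mu$ (all jointly measurable in their arguments and indices). The notation $Z\sim f$ means that $Z$ has density $f$. Thus the density of $X$ given $\theta$ is $\int_{\mathcal K}f_{\theta,k}(x)g(k)\,d\mu(k)$, and the density of $Y$ given $\theta$ is $q(y\mid\theta)=\int_{\mathcal K}q_{\theta,j}(y)h(j)\,d\mu(j)$. The posterior density $\pi(\theta\mid x)$ is the density with respect to $\tau$ proportional, in $\theta$, to $\pi(\theta)\int_{\mathcal K}f_{\theta,k}(x)g(k)\,d\mu(k)$. The Bayes predictive density of $Y$ is the conditional density of $Y$ given $X=x$, i.e. $q_\pi(y\mid x)=\int_\Theta q(y\mid\theta)\,\pi(\theta\mid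 x)\,d\tau(\theta)$. Conventions: densities are identified when equal almost everywhere with respect to the dominating measure; $x$ is such that the normalizing constant $\int_{\mathcal K}g(k)m_{\pi,k}(x)\,d\mu(k)$ (the marginal density of $X$ at $x$) is positive and finite; $\pi_{k,x}$ is defined by the formula for $k$ with $0<m_{\pi,k}(x)<\infty$ and is an arbitrary (measurable in $k$) density otherwise; $0\cdot\infty=0$. *)

theory Defs
  imports "HOL-Probability.Probability"
begin

(* Densities are ennreal-valued and integrated with the nonnegative Lebesgue integral, as in the
   library's density and distributed.  The ennreal conventions used below are 0 * top = 0,
   a / top = 0, 0 / 0 = 0 and a / 0 = top for a > 0. *)

definition prob_density :: "'a measure \<Rightarrow> ('a \<Rightarrow> ennreal) \<Rightarrow> bool" where
  "prob_density N p \<longleftrightarrow> p \<in> borel_measurable N \<and> (\<integral>\<^sup>+z. p z \<partial>N) = 1"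

(* p v is the density of W given V = v with respect to N, i.e.
   P(V in A, W in B) = integral over v in A of (integral over w in B of p v w dN) dP_V
   for all measurable A, B; p is jointly measurable.  Only the values of p for P_V-almost
   every v matter. *)
definition has_cond_density ::
  "'w measure \<Rightarrow> 'v measure \<Rightarrow> 'z measure \<Rightarrow> ('w \<Rightarrow> 'v) \<Rightarrow> ('w \<Rightarrow> 'z) \<Rightarrow> ('v \<Rightarrow> 'z \<Rightarrow> ennreal) \<Rightarrow> bool"
  where
  "has_cond_density M S N V W p \<longleftrightarrow>
     V \<in> measurable M S \<and>
     distributed M (distr M S V \<Otimes>\<^sub>M N) (\<lambda>\<omega>. (V \<omega>, W \<omega>)) (\<lambda>(v, w). p v w)"

definition cond_indep_given ::
  "'w measure \<Rightarrow> 'v measure \<Rightarrow> ('w \<Rightarrow> 'v) \<Rightarrow> 'a measure \<Rightarrow> ('w \<Rightarrow> 'a) \<Rightarrow> 'b measure \<Rightarrow> ('w \<Rightarrow> 'b) \<Rightarrow> bool"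
  where
  "cond_indep_given M S V N1 X N2 Y \<longleftrightarrow>
     V \<in> measurable M S \<and> X \<in> measurable M N1 \<and> Y \<in> measurable M N2 \<and>
     (let P = (\<lambda>E. real_cond_exp M (vimage_algebra (space M) V S) (indicator E)) in
      \<forall>A\<in>sets N1. \<forall>B\<in>sets N2. AE \<omega> in M.
        P ((X -` A \<inter> space M) \<inter> (Y -` B \<inter> space M)) \<omega>
          = P (X -` A \<inter> space M) \<omega> * P (Y -` B \<inter> space M) \<omega>)"

(* f \<theta> k x is the component density at x, g the mixing density.  The same function gives the
   density of X given \<theta> (from f, g) and the density q(y | \<theta>) of Y given \<theta> (from q, h). *)
definition mix_density ::
  "'k measure \<Rightarrow> ('t \<Rightarrow> 'k \<Rightarrow> 'x \<Rightarrow> ennreal) \<Rightarrow> ('k \<Rightarrow> ennreal) \<Rightarrow> 't \<Rightarrow> 'x \<Rightarrow> ennreal" where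
  "mix_density \<mu> f g \<theta> x = (\<integral>\<^sup>+k. f \<theta> k x * g k \<partial>\<mu>)"

definition posterior ::
  "'t measure \<Rightarrow> 'k measure \<Rightarrow> ('t \<Rightarrow> 'k \<Rightarrow> 'x \<Rightarrow> ennreal) \<Rightarrow> ('k \<Rightarrow> ennreal) \<Rightarrow> ('t \<Rightarrow> ennreal) \<Rightarrow> 'x \<Rightarrow> 't \<Rightarrow> ennreal"
  where
  "posterior \<tau> \<mu> f g \<pi> x \<theta> =
     \<pi> \<theta> * mix_density \<mu> f g \<theta> x / (\<integral>\<^sup>+\<theta>'. \<pi> \<theta>' * mix_density \<mu> f g \<theta>' x \<partial>\<tau>)"

definition predictive ::
  "'t measure \<Rightarrow> 'k measure \<Rightarrow> ('t \<Rightarrow> 'k \<Rightarrow> 'x \<Rightarrow> ennreal) \<Rightarrow> ('k \<Rightarrow> ennreal) \<Rightarrow> ('t \<Rightarrow> 'k \<Rightarrow> 'y \<Rightarrow> ennreal)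
     \<Rightarrow> ('k \<Rightarrow> ennreal) \<Rightarrow> ('t \<Rightarrow> ennreal) \<Rightarrow> 'x \<Rightarrow> 'y \<Rightarrow> ennreal"
  where
  "predictive \<tau> \<mu> f g q h \<pi> x y =
     (\<integral>\<^sup>+\<theta>. mix_density \<mu> q h \<theta> y * posterior \<tau> \<mu> f g \<pi> x \<theta> \<partial>\<tau>)"

definition m_comp ::
  "'t measure \<Rightarrow> ('t \<Rightarrow> 'k \<Rightarrow> 'x \<Rightarrow> ennreal) \<Rightarrow> ('t \<Rightarrow> ennreal) \<Rightarrow> 'k \<Rightarrow> 'x \<Rightarrow> ennreal" where
  "m_comp \<tau> f \<pi> k x = (\<integral>\<^sup>+\<theta>. f \<theta> k x * \<pi> \<theta> \<partial>\<tau>)"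

definition marginal ::
  "'t measure \<Rightarrow> 'k measure \<Rightarrow> ('t \<Rightarrow> 'k \<Rightarrow> 'x \<Rightarrow> ennreal) \<Rightarrow> ('k \<Rightarrow> ennreal) \<Rightarrow> ('t \<Rightarrow> ennreal) \<Rightarrow> 'x \<Rightarrow> ennreal"
  where
  "marginal \<tau> \<mu> f g \<pi> x = (\<integral>\<^sup>+k. g k * m_comp \<tau> f \<pi> k x \<partial>\<mu>)"

definition mixing_post ::
  "'t measure \<Rightarrow> 'k measure \<Rightarrow> ('t \<Rightarrow> 'k \<Rightarrow> 'x \<Rightarrow> ennreal) \<Rightarrow> ('k \<Rightarrow> ennreal) \<Rightarrow> ('t \<Rightarrow> ennreal) \<Rightarrow> 'x \<Rightarrow> 'k \<Rightarrow> ennreal"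
  where
  "mixing_post \<tau> \<mu> f g \<pi> x k = g k * m_comp \<tau> f \<pi> k x / marginal \<tau> \<mu> f g \<pi> x"

definition comp_post_formula ::
  "'t measure \<Rightarrow> ('t \<Rightarrow> 'k \<Rightarrow> 'x \<Rightarrow> ennreal) \<Rightarrow> ('t \<Rightarrow> ennreal) \<Rightarrow> 'k \<Rightarrow> 'x \<Rightarrow> 't \<Rightarrow> ennreal" where
  "comp_post_formula \<tau> f \<pi> k x \<theta> = \<pi> \<theta> * f \<theta> k x / m_comp \<tau> f \<pi> k x"

(* The admissible families k \<mapsto> \<pi>_{k,x} for a fixed x: given by the formula where
   0 < m_{\<pi>,k}(x) < \<infinity>, and an arbitrary probability density for the other k. *)
definition is_comp_post ::
  "'t measure \<Rightarrow> 'k measure \<Rightarrow> ('t \<Rightarrow> 'k \<Rightarrow> 'x \<Rightarrow> ennreal) \<Rightarrow> ('t \<Rightarrow> ennreal) \<Rightarrow> 'x \<Rightarrow> ('k \<Rightarrow> 't \<Rightarrow> ennreal) \<Rightarrow> bool"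
  where
  "is_comp_post \<tau> \<mu> f \<pi> x pk \<longleftrightarrow>
     (\<lambda>(k, \<theta>). pk k \<theta>) \<in> borel_measurable (\<mu> \<Otimes>\<^sub>M \<tau>) \<and>
     (\<forall>k\<in>space \<mu>. prob_density \<tau> (pk k)) \<and>
     (\<forall>k\<in>space \<mu>. 0 < m_comp \<tau> f \<pi> k x \<and> m_comp \<tau> f \<pi> k x < \<infinity> \<longrightarrow>
        (\<forall>\<theta>\<in>space \<tau>. pk k \<theta> = comp_post_formula \<tau> f \<pi> k x \<theta>))"

(* q_\<pi>(y | j, k) and q'_{x,j}(y), for a given family pk of densities \<pi>_{k,x}. *)
definition comp_predictive ::
  "'t measure \<Rightarrow> ('t \<Rightarrow> 'k \<Rightarrow> 'y \<Rightarrow> ennreal) \<Rightarrow> ('k \<Rightarrow> 't \<Rightarrow> ennreal) \<Rightarrow> 'k \<Rightarrow> 'k \<Rightarrow> 'y \<Rightarrow> ennreal" where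
  "comp_predictive \<tau> q pk j k y = (\<integral>\<^sup>+\<theta>. q \<theta> j y * pk k \<theta> \<partial>\<tau>)"

definition comp_predictive' ::
  "'t measure \<Rightarrow> 'k measure \<Rightarrow> ('t \<Rightarrow> 'k \<Rightarrow> 'x \<Rightarrow> ennreal) \<Rightarrow> ('k \<Rightarrow> ennreal) \<Rightarrow> ('t \<Rightarrow> 'k \<Rightarrow> 'y \<Rightarrow> ennreal)
     \<Rightarrow> ('t \<Rightarrow> ennreal) \<Rightarrow> ('k \<Rightarrow> 't \<Rightarrow> ennreal) \<Rightarrow> 'x \<Rightarrow> 'k \<Rightarrow> 'y \<Rightarrow> ennreal" where
  "comp_predictive' \<tau> \<mu> f g q \<pi> pk x j y =
     (\<integral>\<^sup>+k. comp_predictive \<tau> q pk j k y * mixing_post \<tau> \<mu> f g \<pi> x k \<partial>\<mu>)"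

end

theory Submission
  imports Defs
begin

text \<open>
  The theorem is Bayes' formula read in two ways.  Put $m_k(x) = \int f_{t,k}(x)\,\pi(t)\,d\tau(t)$.
  The triple $(\theta, K, X)$ has the joint density $\pi(t)\,g(k)\,f_{t,k}(x)$.  Integrating out components
  gives $g(k)\,m_k(x)$ for $(X, K)$, $\pi(t) \int f_{t,k}(x)\,g(k)\,d\mu(k)$ for $(\theta, X)$ and the marginal
  density for $X$, and each formula in the theorem is a quotient of two of these.  Such a quotient is a
  conditional density by \<open>has_cond_densityI\<close>: the extended-real conventions for division by $0$ or
  $\infty$ matter only on null sets or where the joint density vanishes too.

  For the predictive density the joint law of $(X, Y)$ is needed.  By \<open>cond_prob_from_cond_density\<close> the
  conditional probabilities given $\theta$ are integrals of the mixture densities, so that conditional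
  independence yields, by \<open>cond_indep_joint_density\<close>, the joint density
  $\int \pi(t)\,f(x \mid t)\,q(y \mid t)\,d\tau(t)$.

  The representations hold for each fixed $x$ with positive and finite marginal density.  In
  $\pi_{k,x}(t)\,g_{\pi,x}(k)$ the factor $m_k(x)$ cancels (\<open>pk_times_mixing_post\<close>), which leaves
  $\pi(t)\,f_{t,k}(x)\,g(k)$ divided by the marginal density; integrating over $k$ gives the posterior
  density.  Integrating the densities $q(y \mid t)$ against this mixture and exchanging the integrals gives
  both forms of the predictive density (\<open>predictive_mixture\<close>).  The statements about distributions
  follow, because a mixture of laws with densities has the mixed density (\<open>bind_density_kernel\<close>).
\<close>

section \<open>Joint, marginal and conditional densities\<close>

lemma has_cond_density_measurable:
  assumes "has_cond_density M S N V W p"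
  shows "(\<lambda>(v, w). p v w) \<in> borel_measurable (S \<Otimes>\<^sub>M N)"
    and "(\<lambda>\<omega>. (V \<omega>, W \<omega>)) \<in> measurable M (S \<Otimes>\<^sub>M N)"
proof -
  have sets_eq: "sets (distr M S V \<Otimes>\<^sub>M N) = sets (S \<Otimes>\<^sub>M N)"
    by (intro sets_pair_measure_cong) auto
  have W: "distributed M (distr M S V \<Otimes>\<^sub>M N) (\<lambda>\<omega>. (V \<omega>, W \<omega>)) (\<lambda>(v, w). p v w)"
    using assms by (simp add: has_cond_density_def)
  show "(\<lambda>(v, w). p v w) \<in> borel_measurable (S \<Otimes>\<^sub>M N)"
    using distributed_borel_measurable[OF W] measurable_cong_sets[OF sets_eq refl] by blast
  show "(\<lambda>\<omega>. (V \<omega>, W \<omega>)) \<in> measurable M (S \<Otimes>\<^sub>M N)"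
    using distributed_measurable[OF W] measurable_cong_sets[OF refl sets_eq] by blast
qed

text \<open>
  The chain rule: the law of $V$ has density $d$, so the base measure of the pair in the definition
  of a conditional density is the product measure $S \otimes N$ weighted by $d$, and successive
  densities multiply.
\<close>

lemma has_cond_density_joint:
  assumes N: "sigma_finite_measure N"
    and V: "distributed M S V d" and W: "has_cond_density M S N V W p" and M: "prob_space M"
  shows "distributed M (S \<Otimes>\<^sub>M N) (\<lambda>\<omega>. (V \<omega>, W \<omega>)) (\<lambda>(v, w). d v * p v w)"
proof -
  interpret M: prob_space M by fact
  interpret N: sigma_finite_measure N by fact
  have V_meas [measurable]: "V \<in> measurable M S" and d [measurable]: "d \<in> borel_measurable S"
    and law_V: "distr M S V = density S d"
    using V by (auto simp: distributed_def)
  have sets_eq: "sets (distr M S V \<Otimes>\<^sub>M N) = sets (S \<Otimes>\<^sub>M N)"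
    by (intro sets_pair_measure_cong) auto
  have W': "distributed M (distr M S V \<Otimes>\<^sub>M N) (\<lambda>\<omega>. (V \<omega>, W \<omega>)) (\<lambda>(v, w). p v w)"
    using W by (auto simp: has_cond_density_def)
  note p [measurable] = has_cond_density_measurable(1)[OF W]
  note VW [measurable] = has_cond_density_measurable(2)[OF W]
  have base: "distr M S V \<Otimes>\<^sub>M N = density (S \<Otimes>\<^sub>M N) (\<lambda>(v, w). d v * 1)"
    using pair_measure_density[OF d, of "\<lambda>_. 1" N] N by (simp add: law_V density_1)
  have "distr M (S \<Otimes>\<^sub>M N) (\<lambda>\<omega>. (V \<omega>, W \<omega>)) = distr M (distr M S V \<Otimes>\<^sub>M N) (\<lambda>\<omega>. (V \<omega>, W \<omega>))"
    by (intro distr_cong) (simp_all add: sets_eq)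
  also have "\<dots> = density (distr M S V \<Otimes>\<^sub>M N) (\<lambda>(v, w). p v w)"
    by (rule distributed_distr_eq_density[OF W'])
  also have "\<dots> = density (S \<Otimes>\<^sub>M N) (\<lambda>(v, w). d v * p v w)"
    unfolding base by (subst density_density_eq) (auto simp: split_beta')
  finally show ?thesis
    by (auto simp: distributed_def)
qed

text \<open>
  The converse of the chain rule: a solution $p$ of $d(v)\,p(v,w) = r(v,w)$ is a conditional
  density.  The equation is demanded only where $0 < d(v) < \infty$, because there it can be solved by
  dividing, in spite of the conventions for division in the extended reals.  The exceptional $v$ do
  no harm.  The marginal density $d$ has integral $1$ and hence is infinite only on a null set, and
  where $d(v) = \int r(v,w)\,dN(w)$ vanishes, so does $r(v,w)$ for almost every $w$.
\<close>

lemma has_cond_densityI: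
  assumes S: "sigma_finite_measure S" and N: "sigma_finite_measure N" and M: "prob_space M"
    and V: "distributed M S V d"
    and VW: "distributed M (S \<Otimes>\<^sub>M N) (\<lambda>\<omega>. (V \<omega>, W \<omega>)) (\<lambda>(v, w). r v w)"
    and p [measurable]: "(\<lambda>(v, w). p v w) \<in> borel_measurable (S \<Otimes>\<^sub>M N)"
    and p_eq: "\<And>v w. \<lbrakk>v \<in> space S; w \<in> space N; 0 < d v; d v < \<infinity>\<rbrakk> \<Longrightarrow> d v * p v w = r v w"
  shows "has_cond_density M S N V W p"
proof -
  interpret M: prob_space M by fact
  interpret S: sigma_finite_measure S by fact
  interpret N: sigma_finite_measure N by fact
  interpret SN: pair_sigma_finite S N ..
  have V_meas [measurable]: "V \<in> measurable M S" and d [measurable]: "d \<in> borel_measurable S"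
    and law_V: "distr M S V = density S d"
    using V by (auto simp: distributed_def)
  have r [measurable]: "(\<lambda>(v, w). r v w) \<in> borel_measurable (S \<Otimes>\<^sub>M N)"
    and VW_meas [measurable]: "(\<lambda>\<omega>. (V \<omega>, W \<omega>)) \<in> measurable M (S \<Otimes>\<^sub>M N)"
    using VW by (auto simp: distributed_def)
  have sets_eq: "sets (distr M S V \<Otimes>\<^sub>M N) = sets (S \<Otimes>\<^sub>M N)"
    by (intro sets_pair_measure_cong) auto
  have "distributed M S V (\<lambda>v. \<integral>\<^sup>+w. r v w \<partial>N)"
    using M.distr_marginal1[OF S N VW] by simp
  from M.distributed_unique[OF V this]
  have d_eq: "AE v in S. d v = (\<integral>\<^sup>+w. r v w \<partial>N)" .
  have "(\<integral>\<^sup>+v. d v \<partial>S) = emeasure (distr M S V) (space S)"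
    by (simp add: law_V emeasure_density nn_integral_set_ennreal cong: nn_integral_cong)
  also have "\<dots> = 1"
    using M.prob_space_distr[OF V_meas] prob_space.emeasure_space_1 by fastforce
  finally have "AE v in S. d v \<noteq> \<infinity>"
    by (intro nn_integral_PInf_AE) auto
  with d_eq AE_space[of S] have "AE v in S. AE w in N. d v * p v w = r v w"
  proof eventually_elim
    case (elim v)
    then have v [measurable]: "v \<in> space S" by simp
    show ?case
    proof (cases "d v = 0")
      case True
      have "AE w in N. r v w = 0"
        using elim True by (subst nn_integral_0_iff_AE[symmetric]) auto
      then show ?thesis by eventually_elim (simp add: True)
    next
      case False
      then show ?thesis
        using elim by (intro AE_I2 p_eq) (auto simp: zero_less_iff_neq_zero top.not_eq_extremum)
    qed
  qed
  then have AE_eq: "AE z in S \<Otimes>\<^sub>M N. (case z of (v, w) \<Rightarrow> d v * p v w) = (case z of (v, w) \<Rightarrow> r v w)"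
    by (intro SN.AE_pair_measure) (auto simp: split_beta')
  have base: "distr M S V \<Otimes>\<^sub>M N = density (S \<Otimes>\<^sub>M N) (\<lambda>(v, w). d v * 1)"
    using pair_measure_density[OF d, of "\<lambda>_. 1" N] N by (simp add: law_V density_1)
  have "distr M (distr M S V \<Otimes>\<^sub>M N) (\<lambda>\<omega>. (V \<omega>, W \<omega>)) = distr M (S \<Otimes>\<^sub>M N) (\<lambda>\<omega>. (V \<omega>, W \<omega>))"
    by (intro distr_cong) (simp_all add: sets_eq)
  also have "\<dots> = density (S \<Otimes>\<^sub>M N) (\<lambda>(v, w). r v w)"
    using VW by (simp add: distributed_def)
  also have "\<dots> = density (S \<Otimes>\<^sub>M N) (\<lambda>(v, w). d v * p v w)"
    using AE_eq by (intro density_cong) (auto elim: eventually_mono)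
  also have "\<dots> = density (distr M S V \<Otimes>\<^sub>M N) (\<lambda>(v, w). p v w)"
    unfolding base by (subst density_density_eq) (auto simp: split_beta')
  finally show ?thesis
    unfolding has_cond_density_def distributed_def
    using measurable_cong_sets[OF sets_eq refl, of borel] measurable_cong_sets[OF refl sets_eq, of M]
    by auto
qed

lemma distributed_marginal:
  assumes M: "prob_space M" and S: "sigma_finite_measure S" and N: "sigma_finite_measure N"
    and VW: "distributed M (S \<Otimes>\<^sub>M N) (\<lambda>\<omega>. (V \<omega>, W \<omega>)) (\<lambda>(v, w). r v w)"
    and d: "\<And>v. v \<in> space S \<Longrightarrow> (\<integral>\<^sup>+w. r v w \<partial>N) = d v"
  shows "distributed M S V d"
proof -
  have V: "distributed M S V (\<lambda>v. \<integral>\<^sup>+w. r v w \<partial>N)"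
    using prob_space.distr_marginal1[OF M S N VW] by simp
  then have [measurable]: "(\<lambda>v. \<integral>\<^sup>+w. r v w \<partial>N) \<in> borel_measurable S"
    by (rule distributed_borel_measurable)
  then have [measurable]: "d \<in> borel_measurable S"
    by (rule measurable_cong[THEN iffD1, rotated]) (rule d)
  have "density S (\<lambda>v. \<integral>\<^sup>+w. r v w \<partial>N) = density S d"
    by (intro density_cong) (auto simp: d)
  with V show ?thesis
    by (auto simp: distributed_def)
qed

section \<open>Reordering the components of a joint density\<close>

text \<open>
  Densities follow a random variable through a measure-preserving map.  This is used for
  reordering the components of a triple, where the map is a rearrangement of product coordinates.
\<close>

lemma distributed_transform:
  assumes Z: "distributed M N Z r"
    and [measurable]: "T \<in> measurable N N'" "r' \<in> borel_measurable N'"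
    and r': "\<And>z. z \<in> space N \<Longrightarrow> r' (T z) = r z"
    and T: "\<And>A. A \<in> sets N' \<Longrightarrow> emeasure N' A = emeasure N (T -` A \<inter> space N)"
  shows "distributed M N' (\<lambda>\<omega>. T (Z \<omega>)) r'"
proof -
  have [measurable]: "Z \<in> measurable M N" "r \<in> borel_measurable N"
    and law: "distr M N Z = density N r"
    using Z by (auto simp: distributed_def)
  have "distr N N' T = N'"
    by (rule measure_eqI) (simp_all add: emeasure_distr T)
  then have "density N' r' = density (distr N N' T) r'"
    by simp
  also have "\<dots> = distr (density N (\<lambda>z. r' (T z))) N' T"
    by (rule density_distr) auto
  also have "density N (\<lambda>z. r' (T z)) = distr M N Z"
    unfolding law by (rule density_cong) (auto simp: r')
  also have "distr (distr M N Z) N' T = distr M N' (\<lambda>\<omega>. T (Z \<omega>))"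
    by (simp add: distr_distr comp_def)
  finally show ?thesis
    by (simp add: distributed_def)
qed

lemma distributed_swap_last:
  assumes S: "sigma_finite_measure A" "sigma_finite_measure B" "sigma_finite_measure C"
    and D: "distributed M ((A \<Otimes>\<^sub>M B) \<Otimes>\<^sub>M C) (\<lambda>\<omega>. ((U \<omega>, V \<omega>), W \<omega>)) (\<lambda>((a, b), c). r a b c)"
  shows "distributed M ((A \<Otimes>\<^sub>M C) \<Otimes>\<^sub>M B) (\<lambda>\<omega>. ((U \<omega>, W \<omega>), V \<omega>)) (\<lambda>((a, c), b). r a b c)"
proof -
  interpret A: sigma_finite_measure A by fact
  interpret B: sigma_finite_measure B by fact
  interpret C: sigma_finite_measure C by fact
  interpret BC: pair_sigma_finite B C ..
  let ?T = "\<lambda>((a, b), c). ((a, c), b)"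
  have r: "(\<lambda>((a, b), c). r a b c) \<in> borel_measurable ((A \<Otimes>\<^sub>M B) \<Otimes>\<^sub>M C)"
    using D by (rule distributed_borel_measurable)
  have T: "?T \<in> measurable ((A \<Otimes>\<^sub>M B) \<Otimes>\<^sub>M C) ((A \<Otimes>\<^sub>M C) \<Otimes>\<^sub>M B)"
    and T': "?T \<in> measurable ((A \<Otimes>\<^sub>M C) \<Otimes>\<^sub>M B) ((A \<Otimes>\<^sub>M B) \<Otimes>\<^sub>M C)"
    unfolding split_beta' by measurable
  have "distributed M ((A \<Otimes>\<^sub>M C) \<Otimes>\<^sub>M B) (\<lambda>\<omega>. ?T ((U \<omega>, V \<omega>), W \<omega>)) (\<lambda>((a, c), b). r a b c)"
  proof (rule distributed_transform[OF D T])
    show "(\<lambda>((a, c), b). r a b c) \<in> borel_measurable ((A \<Otimes>\<^sub>M C) \<Otimes>\<^sub>M B)"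
      using measurable_compose[OF T' r] by (simp add: split_beta')
    fix E assume E [measurable]: "E \<in> sets ((A \<Otimes>\<^sub>M C) \<Otimes>\<^sub>M B)"
    have "emeasure ((A \<Otimes>\<^sub>M C) \<Otimes>\<^sub>M B) E = (\<integral>\<^sup>+z. indicator E z \<partial>((A \<Otimes>\<^sub>M C) \<Otimes>\<^sub>M B))"
      by simp
    also have "\<dots> = (\<integral>\<^sup>+a. (\<integral>\<^sup>+c. (\<integral>\<^sup>+b. indicator E ((a, c), b) \<partial>B) \<partial>C) \<partial>A)"
      by (simp add: B.nn_integral_fst[symmetric] C.nn_integral_fst[symmetric] del: nn_integral_indicator)
    also have "\<dots> = (\<integral>\<^sup>+a. (\<integral>\<^sup>+b. (\<integral>\<^sup>+c. indicator E ((a, c), b) \<partial>C) \<partial>B) \<partial>A)"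
      by (intro nn_integral_cong BC.Fubini') measurable
    also have "\<dots> = (\<integral>\<^sup>+z. indicator E (?T z) \<partial>((A \<Otimes>\<^sub>M B) \<Otimes>\<^sub>M C))"
      by (simp add: B.nn_integral_fst[symmetric] C.nn_integral_fst[symmetric] split_beta')
    also have "\<dots> = (\<integral>\<^sup>+z. indicator (?T -` E \<inter> space ((A \<Otimes>\<^sub>M B) \<Otimes>\<^sub>M C)) z \<partial>((A \<Otimes>\<^sub>M B) \<Otimes>\<^sub>M C))"
      by (intro nn_integral_cong) (auto split: split_indicator)
    also have "\<dots> = emeasure ((A \<Otimes>\<^sub>M B) \<Otimes>\<^sub>M C) (?T -` E \<inter> space ((A \<Otimes>\<^sub>M B) \<Otimes>\<^sub>M C))"
      using measurable_sets[OF T E] by (rule nn_integral_indicator)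
    finally show "emeasure ((A \<Otimes>\<^sub>M C) \<Otimes>\<^sub>M B) E = emeasure ((A \<Otimes>\<^sub>M B) \<Otimes>\<^sub>M C) (?T -` E \<inter> space ((A \<Otimes>\<^sub>M B) \<Otimes>\<^sub>M C))" .
  qed auto
  then show ?thesis by simp
qed

lemma distributed_swap_first:
  assumes S: "sigma_finite_measure A" "sigma_finite_measure B" "sigma_finite_measure C"
    and D: "distributed M ((A \<Otimes>\<^sub>M B) \<Otimes>\<^sub>M C) (\<lambda>\<omega>. ((U \<omega>, V \<omega>), W \<omega>)) (\<lambda>((a, b), c). r a b c)"
  shows "distributed M ((B \<Otimes>\<^sub>M A) \<Otimes>\<^sub>M C) (\<lambda>\<omega>. ((V \<omega>, U \<omega>), W \<omega>)) (\<lambda>((b, a), c). r a b c)"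
proof -
  interpret A: sigma_finite_measure A by fact
  interpret B: sigma_finite_measure B by fact
  interpret C: sigma_finite_measure C by fact
  interpret BA: pair_sigma_finite B A ..
  let ?T = "\<lambda>((a, b), c). ((b, a), c)"
  have r: "(\<lambda>((a, b), c). r a b c) \<in> borel_measurable ((A \<Otimes>\<^sub>M B) \<Otimes>\<^sub>M C)"
    using D by (rule distributed_borel_measurable)
  have T: "?T \<in> measurable ((A \<Otimes>\<^sub>M B) \<Otimes>\<^sub>M C) ((B \<Otimes>\<^sub>M A) \<Otimes>\<^sub>M C)"
    and T': "?T \<in> measurable ((B \<Otimes>\<^sub>M A) \<Otimes>\<^sub>M C) ((A \<Otimes>\<^sub>M B) \<Otimes>\<^sub>M C)"
    unfolding split_beta' by measurable
  have "distributed M ((B \<Otimes>\<^sub>M A) \<Otimes>\<^sub>M C) (\<lambda>\<omega>. ?T ((U \<omega>, V \<omega>), W \<omega>)) (\<lambda>((b, a), c). r a b c)"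
  proof (rule distributed_transform[OF D T])
    show "(\<lambda>((b, a), c). r a b c) \<in> borel_measurable ((B \<Otimes>\<^sub>M A) \<Otimes>\<^sub>M C)"
      using measurable_compose[OF T' r] by (simp add: split_beta')
    fix E assume E [measurable]: "E \<in> sets ((B \<Otimes>\<^sub>M A) \<Otimes>\<^sub>M C)"
    have "emeasure ((B \<Otimes>\<^sub>M A) \<Otimes>\<^sub>M C) E = (\<integral>\<^sup>+z. indicator E z \<partial>((B \<Otimes>\<^sub>M A) \<Otimes>\<^sub>M C))"
      by simp
    also have "\<dots> = (\<integral>\<^sup>+b. (\<integral>\<^sup>+a. (\<integral>\<^sup>+c. indicator E ((b, a), c) \<partial>C) \<partial>A) \<partial>B)"
      by (simp add: A.nn_integral_fst[symmetric] C.nn_integral_fst[symmetric] del: nn_integral_indicator)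
    also have "\<dots> = (\<integral>\<^sup>+a. (\<integral>\<^sup>+b. (\<integral>\<^sup>+c. indicator E ((b, a), c) \<partial>C) \<partial>B) \<partial>A)"
      by (intro BA.Fubini'[symmetric]) measurable
    also have "\<dots> = (\<integral>\<^sup>+z. indicator E (?T z) \<partial>((A \<Otimes>\<^sub>M B) \<Otimes>\<^sub>M C))"
      by (simp add: B.nn_integral_fst[symmetric] C.nn_integral_fst[symmetric] split_beta')
    also have "\<dots> = (\<integral>\<^sup>+z. indicator (?T -` E \<inter> space ((A \<Otimes>\<^sub>M B) \<Otimes>\<^sub>M C)) z \<partial>((A \<Otimes>\<^sub>M B) \<Otimes>\<^sub>M C))"
      by (intro nn_integral_cong) (auto split: split_indicator)
    also have "\<dots> = emeasure ((A \<Otimes>\<^sub>M B) \<Otimes>\<^sub>M C) (?T -` E \<inter> space ((A \<Otimes>\<^sub>M B) \<Otimes>\<^sub>M C))"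
      using measurable_sets[OF T E] by (rule nn_integral_indicator)
    finally show "emeasure ((B \<Otimes>\<^sub>M A) \<Otimes>\<^sub>M C) E = emeasure ((A \<Otimes>\<^sub>M B) \<Otimes>\<^sub>M C) (?T -` E \<inter> space ((A \<Otimes>\<^sub>M B) \<Otimes>\<^sub>M C))" .
  qed auto
  then show ?thesis by simp
qed

section \<open>Mixtures of laws with densities\<close>

text \<open>
  A mixture of distributions that have densities has the mixture of the densities as its density:
  both sides give a set $E$ the mass $\int\int_E p(k,z)\,dN(z)\,dP(k)$, by Tonelli.
  $P$ is kept apart from $S$, whose \<open>\<sigma>\<close>-algebra it shares, so that $P$ can itself be given by a
  density with respect to $S$.
\<close>

lemma bind_density_kernel:
  assumes N: "sigma_finite_measure N" and P: "sigma_finite_measure P" "space P \<noteq> {}"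
    and sets_P: "sets P = sets S"
    and p [measurable]: "(\<lambda>(k, z). p k z) \<in> borel_measurable (S \<Otimes>\<^sub>M N)"
    and prob: "\<And>k. k \<in> space S \<Longrightarrow> (\<integral>\<^sup>+z. p k z \<partial>N) = 1"
  shows "bind P (\<lambda>k. density N (p k)) = density N (\<lambda>z. \<integral>\<^sup>+k. p k z \<partial>P)"
proof (rule measure_eqI)
  interpret N: sigma_finite_measure N by fact
  interpret P: sigma_finite_measure P by fact
  interpret PN: pair_sigma_finite P N ..
  note sets_P [measurable_cong]
  have space_P: "space P = space S"
    using sets_P by (rule sets_eq_imp_space_eq)
  have kernel: "(\<lambda>k. density N (p k)) \<in> measurable P (subprob_algebra N)"
  proof (rule measurable_subprob_algebra)
    fix k assume k: "k \<in> space P"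
    then have "emeasure (density N (p k)) (space N) = 1"
      using prob[of k] by (simp add: space_P emeasure_density cong: nn_integral_cong)
    then show "subprob_space (density N (p k))"
      using P(2) by (intro prob_space_imp_subprob_space prob_spaceI) simp
  next
    fix E assume [measurable]: "E \<in> sets N"
    have "(\<lambda>k. \<integral>\<^sup>+z. p k z * indicator E z \<partial>N) \<in> borel_measurable P"
      by measurable
    then show "(\<lambda>k. emeasure (density N (p k)) E) \<in> borel_measurable P"
      by (rule measurable_cong[THEN iffD1, rotated]) (simp add: emeasure_density space_P)
  qed simp
  show "sets (bind P (\<lambda>k. density N (p k))) = sets (density N (\<lambda>z. \<integral>\<^sup>+k. p k z \<partial>P))"
    using P(2) by (subst sets_bind[where N = N]) auto
  fix E assume "E \<in> sets (bind P (\<lambda>k. density N (p k)))"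
  then have E [measurable]: "E \<in> sets N"
    using P(2) by (subst (asm) sets_bind[where N = N]) auto
  have "emeasure (bind P (\<lambda>k. density N (p k))) E = (\<integral>\<^sup>+k. emeasure (density N (p k)) E \<partial>P)"
    using P(2) kernel E by (rule emeasure_bind)
  also have "\<dots> = (\<integral>\<^sup>+k. (\<integral>\<^sup>+z. p k z * indicator E z \<partial>N) \<partial>P)"
    by (intro nn_integral_cong) (simp add: emeasure_density space_P)
  also have "\<dots> = (\<integral>\<^sup>+z. (\<integral>\<^sup>+k. p k z * indicator E z \<partial>P) \<partial>N)"
    by (intro PN.Fubini'[symmetric]) measurable
  also have "\<dots> = emeasure (density N (\<lambda>z. \<integral>\<^sup>+k. p k z \<partial>P)) E"
    by (auto simp: emeasure_density intro!: nn_integral_cong nn_integral_multc)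
  finally show "emeasure (bind P (\<lambda>k. density N (p k))) E
    = emeasure (density N (\<lambda>z. \<integral>\<^sup>+k. p k z \<partial>P)) E" .
qed

section \<open>Conditional independence\<close>

text \<open>
  This links the two descriptions of conditioning: the conditional expectation of the indicator of
  $\{W \in E\}$ with respect to the \<open>\<sigma>\<close>-algebra generated by $V$ is the mass that the conditional density
  gives to $E$.  Over an event $\{V \in C\}$ both integrate to $P(V \in C, W \in E)$, and this
  characterises the conditional expectation.
\<close>

lemma cond_prob_from_cond_density:
  assumes M: "prob_space M" and N: "sigma_finite_measure N"
    and W: "has_cond_density M S N V W p" and E [measurable]: "E \<in> sets N"
  shows "AE \<omega> in M. ennreal (real_cond_exp M (vimage_algebra (space M) V S)
      (indicator (W -` E \<inter> space M)) \<omega>) = (\<integral>\<^sup>+w. p (V \<omega>) w * indicator E w \<partial>N)"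
proof -
  interpret M: prob_space M by fact
  interpret N: sigma_finite_measure N by fact
  define F where "F = vimage_algebra (space M) V S"
  define a where "a v = (\<integral>\<^sup>+w. p v w * indicator E w \<partial>N)" for v
  have V [measurable]: "V \<in> measurable M S"
    and W': "distributed M (distr M S V \<Otimes>\<^sub>M N) (\<lambda>\<omega>. (V \<omega>, W \<omega>)) (\<lambda>(v, w). p v w)"
    using W by (auto simp: has_cond_density_def)
  note p [measurable] = has_cond_density_measurable(1)[OF W]
  note VW [measurable] = has_cond_density_measurable(2)[OF W]
  have W_meas [measurable]: "W \<in> measurable M N"
    using measurable_compose[OF VW measurable_snd] by simp
  have a [measurable]: "a \<in> borel_measurable S"
    unfolding a_def by measurable
  have V_F [measurable]: "V \<in> measurable F S"
    unfolding F_def by (rule measurable_vimage_algebra1) (use measurable_space[OF V] in auto)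
  interpret F: finite_measure_subalgebra M F
  proof unfold_locales
    show "subalgebra M F"
      unfolding subalgebra_def F_def
      using measurable_sets[OF V] by (auto simp: sets_vimage_algebra2 measurable_space[OF V])
  qed
  have mass: "emeasure M (V -` C \<inter> W -` E \<inter> space M) = (\<integral>\<^sup>+\<omega>. a (V \<omega>) * indicator C (V \<omega>) \<partial>M)"
    if C [measurable]: "C \<in> sets S" for C
  proof -
    have "emeasure M (V -` C \<inter> W -` E \<inter> space M)
        = emeasure M ((\<lambda>\<omega>. (V \<omega>, W \<omega>)) -` (C \<times> E) \<inter> space M)"
      by (intro arg_cong2[where f = emeasure]) auto
    also have "\<dots> = emeasure (distr M (distr M S V \<Otimes>\<^sub>M N) (\<lambda>\<omega>. (V \<omega>, W \<omega>))) (C \<times> E)"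
      by (subst emeasure_distr[OF distributed_measurable[OF W']]) auto
    also have "\<dots> = (\<integral>\<^sup>+z. (case z of (v, w) \<Rightarrow> p v w) * indicator (C \<times> E) z \<partial>(distr M S V \<Otimes>\<^sub>M N))"
      unfolding distributed_distr_eq_density[OF W'] by (rule emeasure_density) auto
    also have "\<dots> = (\<integral>\<^sup>+v. (\<integral>\<^sup>+w. p v w * indicator (C \<times> E) (v, w) \<partial>N) \<partial>distr M S V)"
      by (subst N.nn_integral_fst[symmetric]) auto
    also have "\<dots> = (\<integral>\<^sup>+v. a v * indicator C v \<partial>distr M S V)"
      unfolding a_def by (intro nn_integral_cong) (simp add: indicator_times nn_integral_multc[symmetric] mult.assoc split: split_indicator)
    also have "\<dots> = (\<integral>\<^sup>+\<omega>. a (V \<omega>) * indicator C (V \<omega>) \<partial>M)"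
      by (subst nn_integral_distr) auto
    finally show ?thesis .
  qed
  define I :: "'a \<Rightarrow> real" where "I = indicator (W -` E \<inter> space M)"
  have [measurable]: "I \<in> borel_measurable M"
    unfolding I_def by measurable
  have pos: "AE \<omega> in M. a (V \<omega>) = nn_cond_exp M F (\<lambda>\<omega>. ennreal (I \<omega>)) \<omega>"
  proof (rule F.nn_cond_exp_charact)
    fix D assume "D \<in> sets F"
    then obtain C where C [measurable]: "C \<in> sets S" and D: "D = V -` C \<inter> space M"
      unfolding F_def by (auto simp: sets_vimage_algebra2 measurable_space[OF V])
    have "(\<integral>\<^sup>+\<omega>\<in>D. ennreal (I \<omega>) \<partial>M) = (\<integral>\<^sup>+\<omega>. indicator (V -` C \<inter> W -` E \<inter> space M) \<omega> \<partial>M)"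
      unfolding D I_def by (intro nn_integral_cong) (auto split: split_indicator)
    also have "\<dots> = (\<integral>\<^sup>+\<omega>. a (V \<omega>) * indicator C (V \<omega>) \<partial>M)"
      by (subst mass[symmetric]) auto
    also have "\<dots> = (\<integral>\<^sup>+\<omega>\<in>D. a (V \<omega>) \<partial>M)"
      unfolding D by (intro nn_integral_cong) (auto split: split_indicator)
    finally show "(\<integral>\<^sup>+\<omega>\<in>D. ennreal (I \<omega>) \<partial>M) = (\<integral>\<^sup>+\<omega>\<in>D. a (V \<omega>) \<partial>M)" .
  qed auto
  \<comment> \<open>The real conditional expectation is a difference of two extended nonnegative ones; for an
    indicator the subtracted one vanishes.\<close>
  have neg: "AE \<omega> in M. 0 = nn_cond_exp M F (\<lambda>\<omega>. ennreal (- I \<omega>)) \<omega>"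
    by (rule F.nn_cond_exp_charact) (auto simp: I_def ennreal_neg)
  have "(\<integral>\<^sup>+\<omega>. a (V \<omega>) \<partial>M) = (\<integral>\<^sup>+\<omega>. a (V \<omega>) * indicator (space S) (V \<omega>) \<partial>M)"
    by (intro nn_integral_cong) (auto simp: measurable_space[OF V])
  also have "\<dots> = emeasure M (V -` space S \<inter> W -` E \<inter> space M)"
    by (rule mass[symmetric]) auto
  also have "\<dots> \<noteq> \<infinity>" by simp
  finally have "AE \<omega> in M. a (V \<omega>) \<noteq> \<infinity>"
    by (intro nn_integral_PInf_AE) auto
  with pos neg show ?thesis
    unfolding F_def[symmetric] a_def[symmetric] I_def[symmetric]
  proof eventually_elim
    case (elim \<omega>)
    then show ?case
      unfolding real_cond_exp_def by (simp add: top.not_eq_extremum flip: elim(1,2))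
  qed
qed

text \<open>
  Taking expectations in the product formula for the conditional probabilities given $V$ yields
  $P(X \in A, Y \in B) = \int d(v) \int_A p(v,x) \int_B q(v,y)$, integrated over $y$, $x$ and $v$.
  By Tonelli this is the integral of the claimed density over $A \times B$, and rectangles determine the
  joint law.
\<close>

lemma cond_indep_joint_density:
  assumes M: "prob_space M" and S: "sigma_finite_measure S"
    and N: "sigma_finite_measure N1" "sigma_finite_measure N2"
    and V: "distributed M S V d"
    and X: "has_cond_density M S N1 V X p" and Y: "has_cond_density M S N2 V Y q"
    and indep: "cond_indep_given M S V N1 X N2 Y"
  shows "distributed M (N1 \<Otimes>\<^sub>M N2) (\<lambda>\<omega>. (X \<omega>, Y \<omega>))
    (\<lambda>(x, y). \<integral>\<^sup>+v. d v * (p v x * q v y) \<partial>S)"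
proof -
  interpret M: prob_space M by fact
  interpret S: sigma_finite_measure S by fact
  interpret N1: sigma_finite_measure N1 by fact
  interpret N2: sigma_finite_measure N2 by fact
  interpret SN1: pair_sigma_finite S N1 ..
  interpret SN2: pair_sigma_finite S N2 ..
  have d [measurable]: "d \<in> borel_measurable S" and law_V: "distr M S V = density S d"
    using V by (auto simp: distributed_def)
  have [measurable]: "V \<in> measurable M S" "X \<in> measurable M N1" "Y \<in> measurable M N2"
    using indep by (auto simp: cond_indep_given_def)
  note [measurable] = has_cond_density_measurable(1)[OF X] has_cond_density_measurable(1)[OF Y]
  define F where "F = vimage_algebra (space M) V S"
  define PE where "PE E = real_cond_exp M F (indicator E)" for E
  interpret F: finite_measure_subalgebra M F
  proof unfold_locales
    show "subalgebra M F"
      unfolding subalgebra_def F_def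
      using measurable_sets[of V M S] measurable_space[of V M S]
      by (auto simp: sets_vimage_algebra2)
  qed
  show ?thesis
  proof (rule M.distributed_jointI[OF N])
    fix A B assume A [measurable]: "A \<in> sets N1" and B [measurable]: "B \<in> sets N2"
    define XA where "XA = X -` A \<inter> space M"
    define YB where "YB = Y -` B \<inter> space M"
    have [measurable]: "XA \<in> sets M" "YB \<in> sets M"
      by (auto simp: XA_def YB_def)
    define a where "a v = (\<integral>\<^sup>+x. p v x * indicator A x \<partial>N1)" for v
    define b where "b v = (\<integral>\<^sup>+y. q v y * indicator B y \<partial>N2)" for v
    have a [measurable]: "a \<in> borel_measurable S"
      unfolding a_def by measurable
    have b [measurable]: "b \<in> borel_measurable S"
      unfolding b_def by measurable
    have PXA: "AE \<omega> in M. ennreal (PE XA \<omega>) = a (V \<omega>)"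
      using cond_prob_from_cond_density[OF M N(1) X A] by (simp add: PE_def F_def XA_def a_def)
    have PYB: "AE \<omega> in M. ennreal (PE YB \<omega>) = b (V \<omega>)"
      using cond_prob_from_cond_density[OF M N(2) Y B] by (simp add: PE_def F_def YB_def b_def)
    have prod: "AE \<omega> in M. PE (XA \<inter> YB) \<omega> = PE XA \<omega> * PE YB \<omega>"
      using indep A B by (simp add: cond_indep_given_def PE_def F_def XA_def YB_def Let_def)
    have nonneg: "AE \<omega> in M. 0 \<le> PE E \<omega>" if [measurable]: "E \<in> sets M" for E
      unfolding PE_def by (rule F.real_cond_exp_pos) auto
    have int: "integrable M (PE (XA \<inter> YB))"
      and int_eq: "(\<integral>\<omega>. PE (XA \<inter> YB) \<omega> \<partial>M) = measure M (XA \<inter> YB)"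
      using F.real_cond_exp_int[of "indicator (XA \<inter> YB)"]
      by (simp_all add: PE_def M.emeasure_eq_measure)
    have XYAB: "{\<omega> \<in> space M. X \<omega> \<in> A \<and> Y \<omega> \<in> B} = XA \<inter> YB"
      by (auto simp: XA_def YB_def)
    have "emeasure M (XA \<inter> YB) = ennreal (\<integral>\<omega>. PE (XA \<inter> YB) \<omega> \<partial>M)"
      by (simp add: int_eq M.emeasure_eq_measure)
    also have "\<dots> = (\<integral>\<^sup>+\<omega>. ennreal (PE (XA \<inter> YB) \<omega>) \<partial>M)"
      by (intro nn_integral_eq_integral[symmetric] int nonneg) auto
    also have "\<dots> = (\<integral>\<^sup>+\<omega>. a (V \<omega>) * b (V \<omega>) \<partial>M)"
      using PXA PYB prod nonneg[OF \<open>XA \<in> sets M\<close>] nonneg[OF \<open>YB \<in> sets M\<close>]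
      by (intro nn_integral_cong_AE, eventually_elim) (auto simp: ennreal_mult)
    also have "\<dots> = (\<integral>\<^sup>+v. a v * b v \<partial>distr M S V)"
      by (subst nn_integral_distr) auto
    also have "\<dots> = (\<integral>\<^sup>+v. d v * (a v * b v) \<partial>S)"
      unfolding law_V by (subst nn_integral_density) auto
    also have "\<dots> = (\<integral>\<^sup>+v. (\<integral>\<^sup>+x. d v * (p v x * b v) * indicator A x \<partial>N1) \<partial>S)"
      unfolding a_def
      by (intro nn_integral_cong) (auto simp: nn_integral_cmult[symmetric] nn_integral_multc[symmetric] ac_simps)
    also have "\<dots> = (\<integral>\<^sup>+x. (\<integral>\<^sup>+v. d v * (p v x * b v) * indicator A x \<partial>S) \<partial>N1)"
      by (intro SN1.Fubini'[symmetric]) measurable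
    also have "\<dots> = (\<integral>\<^sup>+x. (\<integral>\<^sup>+v. (\<integral>\<^sup>+y. d v * (p v x * q v y) * indicator B y \<partial>N2) \<partial>S) * indicator A x \<partial>N1)"
    proof (intro nn_integral_cong)
      fix x assume x [measurable]: "x \<in> space N1"
      have "(\<integral>\<^sup>+v. d v * (p v x * b v) * indicator A x \<partial>S) = (\<integral>\<^sup>+v. d v * (p v x * b v) \<partial>S) * indicator A x"
        by (rule nn_integral_multc) measurable
      also have "(\<integral>\<^sup>+v. d v * (p v x * b v) \<partial>S) = (\<integral>\<^sup>+v. (\<integral>\<^sup>+y. d v * (p v x * q v y) * indicator B y \<partial>N2) \<partial>S)"
        unfolding b_def
        by (intro nn_integral_cong) (auto simp: nn_integral_cmult[symmetric] ac_simps)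
      finally show "(\<integral>\<^sup>+v. d v * (p v x * b v) * indicator A x \<partial>S) = \<dots> * indicator A x" .
    qed
    also have "\<dots> = (\<integral>\<^sup>+x. (\<integral>\<^sup>+y. (\<integral>\<^sup>+v. d v * (p v x * q v y) * indicator B y \<partial>S) \<partial>N2) * indicator A x \<partial>N1)"
      by (intro nn_integral_cong arg_cong2[where f = "(*)"] SN2.Fubini'[symmetric] refl) measurable
    also have "\<dots> = (\<integral>\<^sup>+x. (\<integral>\<^sup>+y. (\<integral>\<^sup>+v. d v * (p v x * q v y) \<partial>S) * indicator B y \<partial>N2) * indicator A x \<partial>N1)"
      by (intro nn_integral_cong arg_cong2[where f = "(*)"] nn_integral_multc refl) measurable
    finally show "emeasure M {\<omega> \<in> space M. X \<omega> \<in> A \<and> Y \<omega> \<in> B}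
      = (\<integral>\<^sup>+x. (\<integral>\<^sup>+y. (case (x, y) of (x, y) \<Rightarrow> \<integral>\<^sup>+v. d v * (p v x * q v y) \<partial>S) * indicator B y \<partial>N2)
          * indicator A x \<partial>N1)"
      by (simp add: XYAB)
  qed auto
qed

section \<open>The posterior of a mixture model\<close>

lemma ennreal_mult_divide_cancel:
  fixes a c :: ennreal
  assumes "0 < c" "c < \<infinity>"
  shows "c * (a / c) = a"
  using assms by (simp add: ennreal_times_divide mult_divide_eq_ennreal mult.commute[of c] zero_less_iff_neq_zero)

text \<open>
  One observation from a mixture: components $f_{t,k}$, mixing density $g$, prior $\pi$.  The locale
  will be instantiated once for $(f, g)$ and once for $(q, h)$.
\<close>

locale bayes_mixture =
  \<tau>: sigma_finite_measure \<tau> + \<mu>: sigma_finite_measure \<mu> + \<nu>: sigma_finite_measure \<nu>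
  for \<tau> :: "'t measure" and \<mu> :: "'k measure" and \<nu> :: "'x measure" +
  fixes f :: "'t \<Rightarrow> 'k \<Rightarrow> 'x \<Rightarrow> ennreal" and g :: "'k \<Rightarrow> ennreal" and \<pi> :: "'t \<Rightarrow> ennreal"
  assumes f_joint: "(\<lambda>(t, k, x). f t k x) \<in> borel_measurable (\<tau> \<Otimes>\<^sub>M \<mu> \<Otimes>\<^sub>M \<nu>)"
    and g_meas [measurable]: "g \<in> borel_measurable \<mu>"
    and \<pi>_meas [measurable]: "\<pi> \<in> borel_measurable \<tau>"
begin

sublocale \<tau>\<mu>: pair_sigma_finite \<tau> \<mu> ..
sublocale \<mu>\<tau>: pair_sigma_finite \<mu> \<tau> ..
sublocale \<mu>\<nu>: pair_sigma_finite \<mu> \<nu> ..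
sublocale \<tau>\<nu>: pair_sigma_finite \<tau> \<nu> ..
sublocale \<nu>\<mu>: pair_sigma_finite \<nu> \<mu> ..

text \<open>
  The joint measurability of $f$ in a form that composes, so that the measurability prover can use it
  with any of the three arguments held fixed.
\<close>

lemma f_measurable [measurable (raw)]:
  assumes [measurable]: "a \<in> measurable L \<tau>" "b \<in> measurable L \<mu>" "c \<in> measurable L \<nu>"
  shows "(\<lambda>z. f (a z) (b z) (c z)) \<in> borel_measurable L"
proof -
  have "(\<lambda>z. (a z, b z, c z)) \<in> measurable L (\<tau> \<Otimes>\<^sub>M \<mu> \<Otimes>\<^sub>M \<nu>)" by measurable
  from measurable_compose[OF this f_joint] show ?thesis by simp
qed

lemma mix_density_measurable [measurable (raw)]:
  assumes [measurable]: "a \<in> measurable L \<tau>" "c \<in> measurable L \<nu>"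
  shows "(\<lambda>z. mix_density \<mu> f g (a z) (c z)) \<in> borel_measurable L"
  unfolding mix_density_def by measurable

lemma m_comp_measurable [measurable (raw)]:
  assumes [measurable]: "b \<in> measurable L \<mu>" "c \<in> measurable L \<nu>"
  shows "(\<lambda>z. m_comp \<tau> f \<pi> (b z) (c z)) \<in> borel_measurable L"
  unfolding m_comp_def by measurable

lemma marginal_measurable [measurable (raw)]:
  assumes [measurable]: "c \<in> measurable L \<nu>"
  shows "(\<lambda>z. marginal \<tau> \<mu> f g \<pi> (c z)) \<in> borel_measurable L"
  unfolding marginal_def by measurable

lemma mixing_post_measurable [measurable (raw)]:
  assumes [measurable]: "b \<in> measurable L \<mu>" "c \<in> measurable L \<nu>"
  shows "(\<lambda>z. mixing_post \<tau> \<mu> f g \<pi> (c z) (b z)) \<in> borel_measurable L"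
  unfolding mixing_post_def by measurable

lemma comp_post_formula_measurable [measurable (raw)]:
  assumes [measurable]: "a \<in> measurable L \<tau>" "b \<in> measurable L \<mu>" "c \<in> measurable L \<nu>"
  shows "(\<lambda>z. comp_post_formula \<tau> f \<pi> (b z) (c z) (a z)) \<in> borel_measurable L"
  unfolding comp_post_formula_def by measurable

lemma normalising_constant:
  assumes [measurable]: "x \<in> space \<nu>"
  shows "(\<integral>\<^sup>+t. \<pi> t * mix_density \<mu> f g t x \<partial>\<tau>) = marginal \<tau> \<mu> f g \<pi> x"
proof -
  have "(\<integral>\<^sup>+t. \<pi> t * mix_density \<mu> f g t x \<partial>\<tau>) = (\<integral>\<^sup>+t. (\<integral>\<^sup>+k. \<pi> t * (f t k x * g k) \<partial>\<mu>) \<partial>\<tau>)"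
    unfolding mix_density_def by (intro nn_integral_cong nn_integral_cmult[symmetric]) measurable
  also have "\<dots> = (\<integral>\<^sup>+k. (\<integral>\<^sup>+t. \<pi> t * (f t k x * g k) \<partial>\<tau>) \<partial>\<mu>)"
    by (intro \<mu>\<tau>.Fubini') measurable
  also have "\<dots> = marginal \<tau> \<mu> f g \<pi> x"
    unfolding marginal_def m_comp_def
    by (intro nn_integral_cong) (auto simp: nn_integral_cmult[symmetric] ac_simps)
  finally show ?thesis .
qed

lemma posterior_eq:
  assumes "x \<in> space \<nu>"
  shows "posterior \<tau> \<mu> f g \<pi> x t = \<pi> t * mix_density \<mu> f g t x / marginal \<tau> \<mu> f g \<pi> x"
  by (simp add: posterior_def normalising_constant[OF assms])

lemma posterior_measurable [measurable (raw)]: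
  assumes [measurable]: "a \<in> measurable L \<tau>" "c \<in> measurable L \<nu>"
  shows "(\<lambda>z. posterior \<tau> \<mu> f g \<pi> (c z) (a z)) \<in> borel_measurable L"
  unfolding posterior_def by measurable

lemma mixing_post_integral:
  assumes [measurable]: "x \<in> space \<nu>"
    and "0 < marginal \<tau> \<mu> f g \<pi> x" "marginal \<tau> \<mu> f g \<pi> x < \<infinity>"
  shows "(\<integral>\<^sup>+k. mixing_post \<tau> \<mu> f g \<pi> x k \<partial>\<mu>) = 1"
proof -
  have "(\<integral>\<^sup>+k. mixing_post \<tau> \<mu> f g \<pi> x k \<partial>\<mu>) = marginal \<tau> \<mu> f g \<pi> x / marginal \<tau> \<mu> f g \<pi> x"
    unfolding mixing_post_def by (subst nn_integral_divide) (auto simp: marginal_def)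
  then show ?thesis using assms by (simp add: zero_less_iff_neq_zero)
qed

lemma prob_space_mixing_post:
  assumes [measurable]: "x \<in> space \<nu>"
    and "0 < marginal \<tau> \<mu> f g \<pi> x" "marginal \<tau> \<mu> f g \<pi> x < \<infinity>"
  shows "prob_space (density \<mu> (mixing_post \<tau> \<mu> f g \<pi> x))"
  using mixing_post_integral[OF assms]
  by (intro prob_spaceI) (simp add: emeasure_density cong: nn_integral_cong)

context
  fixes x :: 'x and pk :: "'k \<Rightarrow> 't \<Rightarrow> ennreal"
  assumes x [measurable]: "x \<in> space \<nu>"
    and marginal_pos: "0 < marginal \<tau> \<mu> f g \<pi> x" and marginal_fin: "marginal \<tau> \<mu> f g \<pi> x < \<infinity>"
    and pk: "is_comp_post \<tau> \<mu> f \<pi> x pk"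
begin

lemma pk_joint: "(\<lambda>(k, t). pk k t) \<in> borel_measurable (\<mu> \<Otimes>\<^sub>M \<tau>)"
  using pk by (simp add: is_comp_post_def)

lemma pk_measurable [measurable (raw)]:
  assumes [measurable]: "a \<in> measurable L \<tau>" "b \<in> measurable L \<mu>"
  shows "(\<lambda>z. pk (b z) (a z)) \<in> borel_measurable L"
proof -
  have "(\<lambda>z. (b z, a z)) \<in> measurable L (\<mu> \<Otimes>\<^sub>M \<tau>)" by measurable
  from measurable_compose[OF this pk_joint] show ?thesis by simp
qed

lemma pk_integral: "k \<in> space \<mu> \<Longrightarrow> (\<integral>\<^sup>+t. pk k t \<partial>\<tau>) = 1"
  using pk by (simp add: is_comp_post_def prob_density_def)

text \<open>
  The heart of the mixture representation: the factor $m_{\pi,k}(x)$ in the weight of $k$ cancels the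
  normalising constant of $\pi_{k,x}$.  The values of $\pi_{k,x}$ that are arbitrary densities are
  harmless.  If $m_{\pi,k}(x) = 0$, the weight is $0$, and $f_{t,k}(x)\,\pi(t) = 0$ for almost every $t$.  If
  $m_{\pi,k}(x) = \infty$, then for almost every such $k$ finiteness of the marginal density forces
  $g(k) = 0$, and both sides are $0$.  The argument thus finds, for almost every $k$, an exceptional null
  set of parameters; Tonelli turns this into the quantifier order needed for integrating over $k$.
\<close>

lemma pk_times_mixing_post:
  "AE t in \<tau>. AE k in \<mu>. pk k t * mixing_post \<tau> \<mu> f g \<pi> x k
     = \<pi> t * (f t k x * g k) / marginal \<tau> \<mu> f g \<pi> x"
proof -
  let ?m = "\<lambda>k. m_comp \<tau> f \<pi> k x" and ?N = "marginal \<tau> \<mu> f g \<pi> x"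
  have "AE k in \<mu>. g k * ?m k \<noteq> \<infinity>"
    using marginal_fin by (intro nn_integral_PInf_AE) (auto simp: marginal_def)
  then have "AE k in \<mu>. AE t in \<tau>. pk k t * mixing_post \<tau> \<mu> f g \<pi> x k
      = \<pi> t * (f t k x * g k) / ?N"
    using AE_space
  proof eventually_elim
    case (elim k)
    then have k [measurable]: "k \<in> space \<mu>" by simp
    consider "?m k = 0" | "?m k = \<infinity>" "g k = 0" | "0 < ?m k" "?m k < \<infinity>"
      using elim by (cases "?m k = 0"; cases "?m k = \<infinity>")
        (auto simp: ennreal_mult_top zero_less_iff_neq_zero top.not_eq_extremum split: if_splits)
    then show ?case
    proof cases
      case 1
      then have "AE t in \<tau>. f t k x * \<pi> t = 0"
        unfolding m_comp_def by (subst (asm) nn_integral_0_iff_AE) auto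
      then show ?thesis
        by eventually_elim (auto simp: 1 mixing_post_def)
    next
      case 2
      then show ?thesis by (simp add: mixing_post_def)
    next
      case 3
      show ?thesis
      proof (rule AE_I2)
        fix t assume "t \<in> space \<tau>"
        then have "pk k t = \<pi> t * f t k x / ?m k"
          using pk k 3 by (simp add: is_comp_post_def comp_post_formula_def)
        then have "pk k t * (g k * ?m k) = g k * (?m k * (\<pi> t * f t k x / ?m k))"
          by (simp add: ac_simps)
        also have "\<dots> = \<pi> t * (f t k x * g k)"
          using 3 by (simp add: ennreal_mult_divide_cancel ac_simps)
        finally show "pk k t * mixing_post \<tau> \<mu> f g \<pi> x k = \<pi> t * (f t k x * g k) / ?N"
          by (simp add: mixing_post_def ennreal_times_divide)
      qed
    qed
  qed
  then show ?thesis
    by (subst \<tau>\<mu>.AE_commute) measurable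
qed

lemma posterior_mixture:
  "AE t in \<tau>. posterior \<tau> \<mu> f g \<pi> x t = (\<integral>\<^sup>+k. pk k t * mixing_post \<tau> \<mu> f g \<pi> x k \<partial>\<mu>)"
  using pk_times_mixing_post AE_space
proof eventually_elim
  case (elim t)
  then have t [measurable]: "t \<in> space \<tau>" by simp
  have "(\<integral>\<^sup>+k. pk k t * mixing_post \<tau> \<mu> f g \<pi> x k \<partial>\<mu>)
      = (\<integral>\<^sup>+k. \<pi> t * (f t k x * g k) / marginal \<tau> \<mu> f g \<pi> x \<partial>\<mu>)"
    using elim by (intro nn_integral_cong_AE) auto
  also have "\<dots> = posterior \<tau> \<mu> f g \<pi> x t"
    by (simp add: posterior_eq[OF x] mix_density_def nn_integral_divide nn_integral_cmult)
  finally show ?case ..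
qed

lemma posterior_eq_bind:
  "density \<tau> (posterior \<tau> \<mu> f g \<pi> x)
     = bind (density \<mu> (mixing_post \<tau> \<mu> f g \<pi> x)) (\<lambda>k. density \<tau> (pk k))"
proof -
  interpret P: prob_space "density \<mu> (mixing_post \<tau> \<mu> f g \<pi> x)"
    by (rule prob_space_mixing_post[OF x marginal_pos marginal_fin])
  have "bind (density \<mu> (mixing_post \<tau> \<mu> f g \<pi> x)) (\<lambda>k. density \<tau> (pk k))
      = density \<tau> (\<lambda>t. \<integral>\<^sup>+k. pk k t \<partial>density \<mu> (mixing_post \<tau> \<mu> f g \<pi> x))"
    by (rule bind_density_kernel[OF _ _ P.not_empty _ pk_joint pk_integral]) (auto intro: \<tau>.sigma_finite_measure_axioms P.sigma_finite_measure)
  also have "\<dots> = density \<tau> (posterior \<tau> \<mu> f g \<pi> x)"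
  proof (rule density_cong)
    show "AE t in \<tau>. (\<integral>\<^sup>+k. pk k t \<partial>density \<mu> (mixing_post \<tau> \<mu> f g \<pi> x)) = posterior \<tau> \<mu> f g \<pi> x t"
      using posterior_mixture AE_space
    proof eventually_elim
      case (elim t)
      then show ?case by (simp add: nn_integral_density mult.commute)
    qed
  qed measurable
  finally show ?thesis ..
qed

end

end

section \<open>Bayes formula for the mixture model\<close>

context bayes_mixture
begin

context
  fixes M :: "'w measure" and \<theta> :: "'w \<Rightarrow> 't" and K :: "'w \<Rightarrow> 'k" and X :: "'w \<Rightarrow> 'x"
  assumes M: "prob_space M" and prior: "distributed M \<tau> \<theta> \<pi>"
    and K: "has_cond_density M \<tau> \<mu> \<theta> K (\<lambda>t. g)"
    and X: "has_cond_density M (\<tau> \<Otimes>\<^sub>M \<mu>) \<nu> (\<lambda>\<omega>. (\<theta> \<omega>, K \<omega>)) X (\<lambda>(t, k). f t k)"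
begin

interpretation M: prob_space M by (rule M)

lemma joint_density:
  "distributed M ((\<tau> \<Otimes>\<^sub>M \<mu>) \<Otimes>\<^sub>M \<nu>) (\<lambda>\<omega>. ((\<theta> \<omega>, K \<omega>), X \<omega>)) (\<lambda>((t, k), x). \<pi> t * g k * f t k x)"
proof -
  have "distributed M (\<tau> \<Otimes>\<^sub>M \<mu>) (\<lambda>\<omega>. (\<theta> \<omega>, K \<omega>)) (\<lambda>(t, k). \<pi> t * g k)"
    by (rule has_cond_density_joint[OF \<mu>.sigma_finite_measure_axioms prior K M])
  from has_cond_density_joint[OF \<nu>.sigma_finite_measure_axioms this X M]
  show ?thesis by (simp add: split_beta')
qed

text \<open>
  A marginal density is obtained by integrating out the last component, and a conditional density
  describes it; this order serves both for the law of $(X, K)$ and for $\theta$ given $(X, K)$.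
\<close>

lemma joint_density_parameter_last:
  "distributed M ((\<nu> \<Otimes>\<^sub>M \<mu>) \<Otimes>\<^sub>M \<tau>) (\<lambda>\<omega>. ((X \<omega>, K \<omega>), \<theta> \<omega>)) (\<lambda>((x, k), t). \<pi> t * g k * f t k x)"
proof -
  note sigma_finite = \<tau>.sigma_finite_measure_axioms \<mu>.sigma_finite_measure_axioms
    \<nu>.sigma_finite_measure_axioms
  have "distributed M ((\<tau> \<Otimes>\<^sub>M \<nu>) \<Otimes>\<^sub>M \<mu>) (\<lambda>\<omega>. ((\<theta> \<omega>, X \<omega>), K \<omega>)) (\<lambda>((t, x), k). \<pi> t * g k * f t k x)"
    by (rule distributed_swap_last[OF sigma_finite joint_density])
  from distributed_swap_first[OF sigma_finite(1,3,2) this]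
  have "distributed M ((\<nu> \<Otimes>\<^sub>M \<tau>) \<Otimes>\<^sub>M \<mu>) (\<lambda>\<omega>. ((X \<omega>, \<theta> \<omega>), K \<omega>)) (\<lambda>((x, t), k). \<pi> t * g k * f t k x)" .
  from distributed_swap_last[OF sigma_finite(3,1,2) this]
  show ?thesis .
qed

lemma density_parameter_observation:
  "distributed M (\<tau> \<Otimes>\<^sub>M \<nu>) (\<lambda>\<omega>. (\<theta> \<omega>, X \<omega>)) (\<lambda>(t, x). \<pi> t * mix_density \<mu> f g t x)"
proof (rule distributed_marginal[OF M])
  show "distributed M ((\<tau> \<Otimes>\<^sub>M \<nu>) \<Otimes>\<^sub>M \<mu>) (\<lambda>\<omega>. ((\<theta> \<omega>, X \<omega>), K \<omega>))
      (\<lambda>(z, k). (\<lambda>(t, x) k. \<pi> t * g k * f t k x) z k)"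
    using distributed_swap_last[OF _ _ _ joint_density] \<tau>.sigma_finite_measure_axioms
      \<mu>.sigma_finite_measure_axioms \<nu>.sigma_finite_measure_axioms
    by (simp add: split_beta')
  fix z assume "z \<in> space (\<tau> \<Otimes>\<^sub>M \<nu>)"
  then obtain t x where z: "z = (t, x)" and [measurable]: "t \<in> space \<tau>" "x \<in> space \<nu>"
    by (auto simp: space_pair_measure)
  have "(\<integral>\<^sup>+k. \<pi> t * g k * f t k x \<partial>\<mu>) = \<pi> t * mix_density \<mu> f g t x"
    unfolding mix_density_def by (subst nn_integral_cmult[symmetric]) (auto simp: ac_simps)
  then show "(\<integral>\<^sup>+k. (\<lambda>(t, x) k. \<pi> t * g k * f t k x) z k \<partial>\<mu>)
      = (\<lambda>(t, x). \<pi> t * mix_density \<mu> f g t x) z"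
    by (simp add: z)
qed unfold_locales

lemma density_observation: "distributed M \<nu> X (marginal \<tau> \<mu> f g \<pi>)"
proof (rule distributed_marginal[OF M])
  show "distributed M (\<nu> \<Otimes>\<^sub>M \<tau>) (\<lambda>\<omega>. (X \<omega>, \<theta> \<omega>)) (\<lambda>(x, t). \<pi> t * mix_density \<mu> f g t x)"
    using M.distributed_swap[OF _ _ density_parameter_observation]
    by (simp add: \<tau>.sigma_finite_measure_axioms \<nu>.sigma_finite_measure_axioms)
qed (unfold_locales, rule normalising_constant)

lemma density_observation_component:
  "distributed M (\<nu> \<Otimes>\<^sub>M \<mu>) (\<lambda>\<omega>. (X \<omega>, K \<omega>)) (\<lambda>(x, k). g k * m_comp \<tau> f \<pi> k x)"
proof (rule distributed_marginal[OF M])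
  show "distributed M ((\<nu> \<Otimes>\<^sub>M \<mu>) \<Otimes>\<^sub>M \<tau>) (\<lambda>\<omega>. ((X \<omega>, K \<omega>), \<theta> \<omega>))
      (\<lambda>(z, t). (\<lambda>(x, k) t. \<pi> t * g k * f t k x) z t)"
    using joint_density_parameter_last by (simp add: split_beta')
  fix z assume "z \<in> space (\<nu> \<Otimes>\<^sub>M \<mu>)"
  then obtain x k where z: "z = (x, k)" and [measurable]: "k \<in> space \<mu>" "x \<in> space \<nu>"
    by (auto simp: space_pair_measure)
  have "(\<integral>\<^sup>+t. \<pi> t * g k * f t k x \<partial>\<tau>) = g k * m_comp \<tau> f \<pi> k x"
    unfolding m_comp_def by (subst nn_integral_cmult[symmetric]) (auto simp: ac_simps)
  then show "(\<integral>\<^sup>+t. (\<lambda>(x, k) t. \<pi> t * g k * f t k x) z t \<partial>\<tau>)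
      = (\<lambda>(x, k). g k * m_comp \<tau> f \<pi> k x) z"
    by (simp add: z)
qed unfold_locales

text \<open>
  This is the density of $X$ given $\theta$ alone, the form in which the conditional independence of $X$
  and $Y$ given $\theta$ can be applied.
\<close>

lemma cond_density_mix: "has_cond_density M \<tau> \<nu> \<theta> X (mix_density \<mu> f g)"
  by (rule has_cond_densityI[OF _ _ M prior density_parameter_observation]) (unfold_locales, auto)

lemma cond_density_mixing_post: "has_cond_density M \<nu> \<mu> X K (mixing_post \<tau> \<mu> f g \<pi>)"
  by (rule has_cond_densityI[OF _ _ M density_observation density_observation_component])
     (unfold_locales, auto simp: mixing_post_def ennreal_mult_divide_cancel)

lemma cond_density_posterior: "has_cond_density M \<nu> \<tau> X \<theta> (posterior \<tau> \<mu> f g \<pi>)"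
proof (rule has_cond_densityI[OF _ _ M density_observation])
  show "distributed M (\<nu> \<Otimes>\<^sub>M \<tau>) (\<lambda>\<omega>. (X \<omega>, \<theta> \<omega>)) (\<lambda>(x, t). \<pi> t * mix_density \<mu> f g t x)"
    using M.distributed_swap[OF _ _ density_parameter_observation]
    by (simp add: \<tau>.sigma_finite_measure_axioms \<nu>.sigma_finite_measure_axioms)
qed (unfold_locales, auto simp: posterior_eq ennreal_mult_divide_cancel)

lemma cond_density_comp_post:
  "has_cond_density M (\<nu> \<Otimes>\<^sub>M \<mu>) \<tau> (\<lambda>\<omega>. (X \<omega>, K \<omega>)) \<theta> (\<lambda>(x, k). comp_post_formula \<tau> f \<pi> k x)"
proof (rule has_cond_densityI[OF _ _ M density_observation_component])
  show "distributed M ((\<nu> \<Otimes>\<^sub>M \<mu>) \<Otimes>\<^sub>M \<tau>) (\<lambda>\<omega>. ((X \<omega>, K \<omega>), \<theta> \<omega>))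
      (\<lambda>(z, t). (\<lambda>(x, k) t. \<pi> t * g k * f t k x) z t)"
    using joint_density_parameter_last by (simp add: split_beta')
  fix z t
  assume pos: "0 < (\<lambda>(x, k). g k * m_comp \<tau> f \<pi> k x) z" and fin: "(\<lambda>(x, k). g k * m_comp \<tau> f \<pi> k x) z < \<infinity>"
  obtain x k where z: "z = (x, k)" by (cases z)
  \<comment> \<open>An infinite \<open>m_comp\<close> would force $g(k) = 0$, since the product is finite, and hence a zero product.\<close>
  have "0 < m_comp \<tau> f \<pi> k x" "m_comp \<tau> f \<pi> k x < \<infinity>"
    using pos fin by (auto simp: z zero_less_iff_neq_zero ennreal_mult_less_top ennreal_mult_top)
  then show "(\<lambda>(x, k). g k * m_comp \<tau> f \<pi> k x) z * (\<lambda>(x, k). comp_post_formula \<tau> f \<pi> k x) z t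
      = (\<lambda>(x, k) t. \<pi> t * g k * f t k x) z t"
    by (simp add: z comp_post_formula_def ennreal_mult_divide_cancel mult.assoc) (simp add: ac_simps)
qed (unfold_locales, auto simp: split_beta')

end

end

section \<open>The predictive density\<close>

text \<open>
  The observation $X$ and the variable $Y$ to be predicted share the parameter and its prior, and the
  space of the mixing variables; their sample spaces may differ.
\<close>

locale bayes_mixture_predictive =
  X: bayes_mixture \<tau> \<mu> \<nu> f g \<pi> + Y: bayes_mixture \<tau> \<mu> \<nu>' q h \<pi>
  for \<tau> :: "'t measure" and \<mu> :: "'k measure" and \<nu> :: "'x measure" and f g \<pi>
    and \<nu>' :: "'y measure" and q h +
  assumes q_prob: "\<And>t j. t \<in> space \<tau> \<Longrightarrow> j \<in> space \<mu> \<Longrightarrow> prob_density \<nu>' (q t j)"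
    and h_prob: "prob_density \<mu> h"
begin

sublocale \<mu>\<mu>: pair_sigma_finite \<mu> \<mu> ..

lemma prob_space_h: "prob_space (density \<mu> h)"
  using h_prob by (intro prob_spaceI) (simp add: prob_density_def emeasure_density cong: nn_integral_cong)

lemma predictive_measurable [measurable (raw)]:
  assumes [measurable]: "c \<in> measurable L \<nu>" "d \<in> measurable L \<nu>'"
  shows "(\<lambda>z. predictive \<tau> \<mu> f g q h \<pi> (c z) (d z)) \<in> borel_measurable L"
  unfolding predictive_def by measurable

text \<open>
  By conditional independence $(X, Y)$ has the joint density
  $\int \pi(t)\,f(x \mid t)\,q(y \mid t)\,d\tau(t)$.  Dividing by the marginal density of $X$ turns
  $\pi(t)\,f(x \mid t)$ into the posterior density, which leaves the predictive density.
\<close>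

lemma cond_density_predictive:
  assumes M: "prob_space M" and prior: "distributed M \<tau> \<theta> \<pi>"
    and K: "has_cond_density M \<tau> \<mu> \<theta> K (\<lambda>t. g)"
    and X: "has_cond_density M (\<tau> \<Otimes>\<^sub>M \<mu>) \<nu> (\<lambda>\<omega>. (\<theta> \<omega>, K \<omega>)) X (\<lambda>(t, k). f t k)"
    and J: "has_cond_density M \<tau> \<mu> \<theta> J (\<lambda>t. h)"
    and Y: "has_cond_density M (\<tau> \<Otimes>\<^sub>M \<mu>) \<nu>' (\<lambda>\<omega>. (\<theta> \<omega>, J \<omega>)) Y (\<lambda>(t, j). q t j)"
    and XY: "cond_indep_given M \<tau> \<theta> \<nu> X \<nu>' Y"
  shows "has_cond_density M \<nu> \<nu>' X Y (predictive \<tau> \<mu> f g q h \<pi>)"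
proof (rule has_cond_densityI[OF _ _ M X.density_observation[OF M prior K X]])
  show "distributed M (\<nu> \<Otimes>\<^sub>M \<nu>') (\<lambda>\<omega>. (X \<omega>, Y \<omega>))
      (\<lambda>(x, y). \<integral>\<^sup>+t. \<pi> t * (mix_density \<mu> f g t x * mix_density \<mu> q h t y) \<partial>\<tau>)"
    by (rule cond_indep_joint_density[OF M _ _ _ prior X.cond_density_mix[OF M prior K X]
          Y.cond_density_mix[OF M prior J Y] XY]) unfold_locales
  fix x y
  assume [measurable]: "x \<in> space \<nu>" "y \<in> space \<nu>'"
    and pos: "0 < marginal \<tau> \<mu> f g \<pi> x" and fin: "marginal \<tau> \<mu> f g \<pi> x < \<infinity>"
  have "marginal \<tau> \<mu> f g \<pi> x * predictive \<tau> \<mu> f g q h \<pi> x y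
      = (\<integral>\<^sup>+t. marginal \<tau> \<mu> f g \<pi> x * (mix_density \<mu> q h t y * posterior \<tau> \<mu> f g \<pi> x t) \<partial>\<tau>)"
    unfolding predictive_def by (intro nn_integral_cmult[symmetric]) measurable
  also have "\<dots> = (\<integral>\<^sup>+t. \<pi> t * (mix_density \<mu> f g t x * mix_density \<mu> q h t y) \<partial>\<tau>)"
  proof (rule nn_integral_cong)
    fix t
    have "marginal \<tau> \<mu> f g \<pi> x * (mix_density \<mu> q h t y * posterior \<tau> \<mu> f g \<pi> x t)
        = mix_density \<mu> q h t y * (marginal \<tau> \<mu> f g \<pi> x * posterior \<tau> \<mu> f g \<pi> x t)"
      by (simp add: ac_simps)
    also have "marginal \<tau> \<mu> f g \<pi> x * posterior \<tau> \<mu> f g \<pi> x t = \<pi> t * mix_density \<mu> f g t x"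
      using pos fin \<open>x \<in> space \<nu>\<close> by (simp add: X.posterior_eq ennreal_mult_divide_cancel)
    finally show "marginal \<tau> \<mu> f g \<pi> x * (mix_density \<mu> q h t y * posterior \<tau> \<mu> f g \<pi> x t)
        = \<pi> t * (mix_density \<mu> f g t x * mix_density \<mu> q h t y)"
      by (simp add: ac_simps)
  qed
  finally show "marginal \<tau> \<mu> f g \<pi> x * predictive \<tau> \<mu> f g q h \<pi> x y
      = (\<integral>\<^sup>+t. \<pi> t * (mix_density \<mu> f g t x * mix_density \<mu> q h t y) \<partial>\<tau>)" .
qed (unfold_locales, auto)

context
  fixes x :: 'x and pk :: "'k \<Rightarrow> 't \<Rightarrow> ennreal"
  assumes x [measurable]: "x \<in> space \<nu>"
    and marginal_pos: "0 < marginal \<tau> \<mu> f g \<pi> x" and marginal_fin: "marginal \<tau> \<mu> f g \<pi> x < \<infinity>"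
    and pk: "is_comp_post \<tau> \<mu> f \<pi> x pk"
begin

lemmas pk_measurable [measurable (raw)] = X.pk_measurable[OF x marginal_pos marginal_fin pk]
lemmas pk_integral = X.pk_integral[OF x marginal_pos marginal_fin pk]

lemma comp_predictive_measurable [measurable (raw)]:
  assumes [measurable]: "a \<in> measurable L \<mu>" "b \<in> measurable L \<mu>" "c \<in> measurable L \<nu>'"
  shows "(\<lambda>z. comp_predictive \<tau> q pk (a z) (b z) (c z)) \<in> borel_measurable L"
  unfolding comp_predictive_def by measurable

lemma comp_predictive'_measurable [measurable (raw)]:
  assumes [measurable]: "a \<in> measurable L \<mu>" "c \<in> measurable L \<nu>'"
  shows "(\<lambda>z. comp_predictive' \<tau> \<mu> f g q \<pi> pk x (a z) (c z)) \<in> borel_measurable L"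
  unfolding comp_predictive'_def by measurable

lemma comp_predictive_integral:
  assumes [measurable]: "j \<in> space \<mu>" "k \<in> space \<mu>"
  shows "(\<integral>\<^sup>+y. comp_predictive \<tau> q pk j k y \<partial>\<nu>') = 1"
proof -
  have "(\<integral>\<^sup>+y. comp_predictive \<tau> q pk j k y \<partial>\<nu>') = (\<integral>\<^sup>+t. (\<integral>\<^sup>+y. q t j y * pk k t \<partial>\<nu>') \<partial>\<tau>)"
    unfolding comp_predictive_def by (intro Y.\<tau>\<nu>.Fubini') measurable
  also have "\<dots> = (\<integral>\<^sup>+t. pk k t \<partial>\<tau>)"
    using q_prob assms by (intro nn_integral_cong) (auto simp: nn_integral_multc prob_density_def)
  finally show ?thesis
    using assms by (simp add: pk_integral)
qed

lemma comp_predictive'_integral: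
  assumes [measurable]: "j \<in> space \<mu>"
  shows "(\<integral>\<^sup>+y. comp_predictive' \<tau> \<mu> f g q \<pi> pk x j y \<partial>\<nu>') = 1"
proof -
  have "(\<integral>\<^sup>+y. comp_predictive' \<tau> \<mu> f g q \<pi> pk x j y \<partial>\<nu>')
      = (\<integral>\<^sup>+k. (\<integral>\<^sup>+y. comp_predictive \<tau> q pk j k y * mixing_post \<tau> \<mu> f g \<pi> x k \<partial>\<nu>') \<partial>\<mu>)"
    unfolding comp_predictive'_def by (intro Y.\<mu>\<nu>.Fubini') measurable
  also have "\<dots> = (\<integral>\<^sup>+k. mixing_post \<tau> \<mu> f g \<pi> x k \<partial>\<mu>)"
    using assms by (intro nn_integral_cong) (auto simp: nn_integral_multc comp_predictive_integral)
  finally show ?thesis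
    using X.mixing_post_integral[OF x marginal_pos marginal_fin] by simp
qed

text \<open>
  The predictive density averages $q(y \mid t)$, a mixture over $j$ with weight $h$, against the posterior,
  a mixture over $k$ with weight $g_{\pi,x}$.  Pulling both mixtures out of the integral over $t$ leaves
  $q_\pi(y \mid j, k)$; the two weights multiply, which is the independence of $J'$ and $K'$.
\<close>

lemma predictive_mixture:
  assumes [measurable]: "y \<in> space \<nu>'"
  shows "predictive \<tau> \<mu> f g q h \<pi> x y
    = (\<integral>\<^sup>+j. (\<integral>\<^sup>+k. comp_predictive \<tau> q pk j k y * mixing_post \<tau> \<mu> f g \<pi> x k * h j \<partial>\<mu>) \<partial>\<mu>)"
proof -
  let ?g = "mixing_post \<tau> \<mu> f g \<pi> x"
  have inner: "(\<integral>\<^sup>+t. mix_density \<mu> q h t y * pk k t \<partial>\<tau>) = (\<integral>\<^sup>+j. comp_predictive \<tau> q pk j k y * h j \<partial>\<mu>)"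
    if [measurable]: "k \<in> space \<mu>" for k
  proof -
    have "(\<integral>\<^sup>+t. mix_density \<mu> q h t y * pk k t \<partial>\<tau>) = (\<integral>\<^sup>+t. (\<integral>\<^sup>+j. q t j y * h j * pk k t \<partial>\<mu>) \<partial>\<tau>)"
      unfolding mix_density_def by (intro nn_integral_cong nn_integral_multc[symmetric]) measurable
    also have "\<dots> = (\<integral>\<^sup>+j. (\<integral>\<^sup>+t. q t j y * h j * pk k t \<partial>\<tau>) \<partial>\<mu>)"
      by (intro X.\<mu>\<tau>.Fubini') measurable
    also have "\<dots> = (\<integral>\<^sup>+j. comp_predictive \<tau> q pk j k y * h j \<partial>\<mu>)"
      unfolding comp_predictive_def
      by (intro nn_integral_cong) (auto simp: nn_integral_cmult[symmetric] ac_simps)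
    finally show ?thesis .
  qed
  have "predictive \<tau> \<mu> f g q h \<pi> x y = (\<integral>\<^sup>+t. mix_density \<mu> q h t y * (\<integral>\<^sup>+k. pk k t * ?g k \<partial>\<mu>) \<partial>\<tau>)"
    unfolding predictive_def
    using X.posterior_mixture[OF x marginal_pos marginal_fin pk]
    by (intro nn_integral_cong_AE) auto
  also have "\<dots> = (\<integral>\<^sup>+t. (\<integral>\<^sup>+k. mix_density \<mu> q h t y * (pk k t * ?g k) \<partial>\<mu>) \<partial>\<tau>)"
    by (intro nn_integral_cong nn_integral_cmult[symmetric]) measurable
  also have "\<dots> = (\<integral>\<^sup>+k. (\<integral>\<^sup>+t. mix_density \<mu> q h t y * (pk k t * ?g k) \<partial>\<tau>) \<partial>\<mu>)"
    by (intro X.\<mu>\<tau>.Fubini') measurable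
  also have "\<dots> = (\<integral>\<^sup>+k. (\<integral>\<^sup>+t. mix_density \<mu> q h t y * pk k t \<partial>\<tau>) * ?g k \<partial>\<mu>)"
    by (intro nn_integral_cong) (auto simp: nn_integral_cmult[symmetric] ac_simps)
  also have "\<dots> = (\<integral>\<^sup>+k. (\<integral>\<^sup>+j. comp_predictive \<tau> q pk j k y * ?g k * h j \<partial>\<mu>) \<partial>\<mu>)"
  proof (intro nn_integral_cong)
    fix k assume k [measurable]: "k \<in> space \<mu>"
    have "(\<integral>\<^sup>+t. mix_density \<mu> q h t y * pk k t \<partial>\<tau>) * ?g k
        = (\<integral>\<^sup>+j. comp_predictive \<tau> q pk j k y * h j * ?g k \<partial>\<mu>)"
      unfolding inner[OF k] by (rule nn_integral_multc[symmetric]) measurable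
    then show "(\<integral>\<^sup>+t. mix_density \<mu> q h t y * pk k t \<partial>\<tau>) * ?g k
        = (\<integral>\<^sup>+j. comp_predictive \<tau> q pk j k y * ?g k * h j \<partial>\<mu>)"
      by (simp add: ac_simps)
  qed
  also have "\<dots> = (\<integral>\<^sup>+j. (\<integral>\<^sup>+k. comp_predictive \<tau> q pk j k y * ?g k * h j \<partial>\<mu>) \<partial>\<mu>)"
    by (intro \<mu>\<mu>.Fubini') measurable
  finally show ?thesis .
qed

text \<open>
  The alternative representation: the integral over $k$ is carried out first, for fixed $j$.
\<close>

lemma predictive_mixture':
  assumes [measurable]: "y \<in> space \<nu>'"
  shows "predictive \<tau> \<mu> f g q h \<pi> x y = (\<integral>\<^sup>+j. comp_predictive' \<tau> \<mu> f g q \<pi> pk x j y * h j \<partial>\<mu>)"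
  unfolding predictive_mixture[OF assms] comp_predictive'_def
  by (intro nn_integral_cong nn_integral_multc) measurable

lemma predictive_eq_bind:
  "density \<nu>' (predictive \<tau> \<mu> f g q h \<pi> x)
    = bind (density \<mu> h \<Otimes>\<^sub>M density \<mu> (mixing_post \<tau> \<mu> f g \<pi> x))
        (\<lambda>(j, k). density \<nu>' (comp_predictive \<tau> q pk j k))"
proof -
  let ?g = "mixing_post \<tau> \<mu> f g \<pi> x"
  interpret P: prob_space "density \<mu> ?g"
    by (rule X.prob_space_mixing_post[OF x marginal_pos marginal_fin])
  interpret H: prob_space "density \<mu> h"
    by (rule prob_space_h)
  interpret HP: pair_prob_space "density \<mu> h" "density \<mu> ?g" ..
  have "bind (density \<mu> h \<Otimes>\<^sub>M density \<mu> ?g) (\<lambda>z. density \<nu>' ((\<lambda>(j, k). comp_predictive \<tau> q pk j k) z))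
      = density \<nu>' (\<lambda>y. \<integral>\<^sup>+z. (\<lambda>(j, k). comp_predictive \<tau> q pk j k) z y \<partial>(density \<mu> h \<Otimes>\<^sub>M density \<mu> ?g))"
  proof (rule bind_density_kernel[where S = "\<mu> \<Otimes>\<^sub>M \<mu>"])
    show "sets (density \<mu> h \<Otimes>\<^sub>M density \<mu> ?g) = sets (\<mu> \<Otimes>\<^sub>M \<mu>)"
      by (intro sets_pair_measure_cong) auto
    show "space (density \<mu> h \<Otimes>\<^sub>M density \<mu> ?g) \<noteq> {}"
      by (rule HP.P.not_empty)
    show "(\<lambda>(z, y). (\<lambda>(j, k). comp_predictive \<tau> q pk j k) z y) \<in> borel_measurable ((\<mu> \<Otimes>\<^sub>M \<mu>) \<Otimes>\<^sub>M \<nu>')"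
      unfolding split_beta' by measurable
  qed (auto simp: space_pair_measure comp_predictive_integral
        intro: Y.\<nu>.sigma_finite_measure_axioms HP.sigma_finite_measure_axioms)
  also have "\<dots> = density \<nu>' (predictive \<tau> \<mu> f g q h \<pi> x)"
  proof (rule density_cong)
    show "AE y in \<nu>'. (\<integral>\<^sup>+z. (\<lambda>(j, k). comp_predictive \<tau> q pk j k) z y \<partial>(density \<mu> h \<Otimes>\<^sub>M density \<mu> ?g))
        = predictive \<tau> \<mu> f g q h \<pi> x y"
    proof (rule AE_I2)
      fix y assume y [measurable]: "y \<in> space \<nu>'"
      have "(\<integral>\<^sup>+z. (\<lambda>(j, k). comp_predictive \<tau> q pk j k) z y \<partial>(density \<mu> h \<Otimes>\<^sub>M density \<mu> ?g))
          = (\<integral>\<^sup>+j. (\<integral>\<^sup>+k. comp_predictive \<tau> q pk j k y \<partial>density \<mu> ?g) \<partial>density \<mu> h)"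
        by (subst P.nn_integral_fst[symmetric]) (auto simp: split_beta')
      also have "\<dots> = (\<integral>\<^sup>+j. comp_predictive' \<tau> \<mu> f g q \<pi> pk x j y \<partial>density \<mu> h)"
        unfolding comp_predictive'_def
        by (intro nn_integral_cong) (auto simp: nn_integral_density mult.commute)
      also have "\<dots> = predictive \<tau> \<mu> f g q h \<pi> x y"
        unfolding predictive_mixture'[OF y] by (auto simp: nn_integral_density mult.commute)
      finally show "(\<integral>\<^sup>+z. (\<lambda>(j, k). comp_predictive \<tau> q pk j k) z y \<partial>(density \<mu> h \<Otimes>\<^sub>M density \<mu> ?g))
          = predictive \<tau> \<mu> f g q h \<pi> x y" .
    qed
    show "(\<lambda>y. \<integral>\<^sup>+z. (\<lambda>(j, k). comp_predictive \<tau> q pk j k) z y \<partial>(density \<mu> h \<Otimes>\<^sub>M density \<mu> ?g))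
        \<in> borel_measurable \<nu>'"
      unfolding split_beta' by measurable
  qed measurable
  finally show ?thesis
    by (simp add: split_beta')
qed

lemma predictive_eq_bind':
  "density \<nu>' (predictive \<tau> \<mu> f g q h \<pi> x)
    = bind (density \<mu> h) (\<lambda>j. density \<nu>' (comp_predictive' \<tau> \<mu> f g q \<pi> pk x j))"
proof -
  interpret H: prob_space "density \<mu> h"
    by (rule prob_space_h)
  have "bind (density \<mu> h) (\<lambda>j. density \<nu>' (comp_predictive' \<tau> \<mu> f g q \<pi> pk x j))
      = density \<nu>' (\<lambda>y. \<integral>\<^sup>+j. comp_predictive' \<tau> \<mu> f g q \<pi> pk x j y \<partial>density \<mu> h)"
    by (rule bind_density_kernel[OF _ _ H.not_empty, where S = \<mu>])
       (auto simp: comp_predictive'_integral Y.\<nu>.sigma_finite_measure_axioms H.sigma_finite_measure_axioms)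
  also have "\<dots> = density \<nu>' (predictive \<tau> \<mu> f g q h \<pi> x)"
    by (intro density_cong AE_I2) (auto simp: predictive_mixture' nn_integral_density mult.commute)
  finally show ?thesis ..
qed

end

end

section \<open>The representation theorem\<close>

theorem theorem4p2:
  fixes M :: "'w measure"
    and \<Theta> :: "(real ^ 'p) set" and \<tau> :: "(real ^ 'p) measure"
    and \<mu> :: "'k measure" and \<nu> :: "(real ^ 'd) measure"
    and f q :: "real ^ 'p \<Rightarrow> 'k \<Rightarrow> real ^ 'd \<Rightarrow> ennreal"
    and g h :: "'k \<Rightarrow> ennreal" and \<pi> :: "real ^ 'p \<Rightarrow> ennreal"
    and \<theta> :: "'w \<Rightarrow> real ^ 'p" and K J :: "'w \<Rightarrow> 'k" and X Y :: "'w \<Rightarrow> real ^ 'd"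
  assumes "prob_space M"
    and "sigma_finite_measure \<tau>" and "sets \<tau> = sets (restrict_space borel \<Theta>)"
    and "sigma_finite_measure \<mu>"
    and "sigma_finite_measure \<nu>" and "sets \<nu> = sets borel"
    and "(\<lambda>(t, k, x). f t k x) \<in> borel_measurable (\<tau> \<Otimes>\<^sub>M \<mu> \<Otimes>\<^sub>M \<nu>)"
    and "(\<lambda>(t, j, y). q t j y) \<in> borel_measurable (\<tau> \<Otimes>\<^sub>M \<mu> \<Otimes>\<^sub>M \<nu>)"
    and "\<And>t k. t \<in> \<Theta> \<Longrightarrow> k \<in> space \<mu> \<Longrightarrow> prob_density \<nu> (f t k)"
    and "\<And>t j. t \<in> \<Theta> \<Longrightarrow> j \<in> space \<mu> \<Longrightarrow> prob_density \<nu> (q t j)"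
    and "prob_density \<mu> g" and "prob_density \<mu> h" and "prob_density \<tau> \<pi>"
    and prior: "distributed M \<tau> \<theta> \<pi>"
    and K: "has_cond_density M \<tau> \<mu> \<theta> K (\<lambda>t. g)"
    and X: "has_cond_density M (\<tau> \<Otimes>\<^sub>M \<mu>) \<nu> (\<lambda>\<omega>. (\<theta> \<omega>, K \<omega>)) X (\<lambda>(t, k). f t k)"
    and J: "has_cond_density M \<tau> \<mu> \<theta> J (\<lambda>t. h)"
    and Y: "has_cond_density M (\<tau> \<Otimes>\<^sub>M \<mu>) \<nu> (\<lambda>\<omega>. (\<theta> \<omega>, J \<omega>)) Y (\<lambda>(t, j). q t j)"
    and XY: "cond_indep_given M \<tau> \<theta> \<nu> X \<nu> Y"
  shows
    \<comment> \<open>the formulas are indeed the conditional densities they are named after\<close>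
    "has_cond_density M (\<nu> \<Otimes>\<^sub>M \<mu>) \<tau> (\<lambda>\<omega>. (X \<omega>, K \<omega>)) \<theta> (\<lambda>(x, k). comp_post_formula \<tau> f \<pi> k x)
     \<and> has_cond_density M \<nu> \<mu> X K (mixing_post \<tau> \<mu> f g \<pi>)
     \<and> has_cond_density M \<nu> \<tau> X \<theta> (posterior \<tau> \<mu> f g \<pi>)
     \<and> has_cond_density M \<nu> \<nu> X Y (predictive \<tau> \<mu> f g q h \<pi>)
     \<and> (\<forall>x pk. 0 < marginal \<tau> \<mu> f g \<pi> x \<longrightarrow> marginal \<tau> \<mu> f g \<pi> x < \<infinity> \<longrightarrow>
          is_comp_post \<tau> \<mu> f \<pi> x pk \<longrightarrow>
          \<comment> \<open>(a)\<close>
          density \<tau> (posterior \<tau> \<mu> f g \<pi> x)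
            = bind (density \<mu> (mixing_post \<tau> \<mu> f g \<pi> x)) (\<lambda>k. density \<tau> (pk k))
          \<and> (AE t in \<tau>. posterior \<tau> \<mu> f g \<pi> x t
              = (\<integral>\<^sup>+k. pk k t * mixing_post \<tau> \<mu> f g \<pi> x k \<partial>\<mu>))
          \<comment> \<open>(b)\<close>
          \<and> density \<nu> (predictive \<tau> \<mu> f g q h \<pi> x)
            = bind (density \<mu> h \<Otimes>\<^sub>M density \<mu> (mixing_post \<tau> \<mu> f g \<pi> x))
                (\<lambda>(j, k). density \<nu> (comp_predictive \<tau> q pk j k))
          \<and> (AE y in \<nu>. predictive \<tau> \<mu> f g q h \<pi> x y
              = (\<integral>\<^sup>+j. (\<integral>\<^sup>+k. comp_predictive \<tau> q pk j k y * mixing_post \<tau> \<mu> f g \<pi> x k * h j \<partial>\<mu>) \<partial>\<mu>))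
          \<comment> \<open>alternative representation in (b)\<close>
          \<and> density \<nu> (predictive \<tau> \<mu> f g q h \<pi> x)
            = bind (density \<mu> h) (\<lambda>j. density \<nu> (comp_predictive' \<tau> \<mu> f g q \<pi> pk x j))
          \<and> (AE y in \<nu>. predictive \<tau> \<mu> f g q h \<pi> x y
              = (\<integral>\<^sup>+j. comp_predictive' \<tau> \<mu> f g q \<pi> pk x j y * h j \<partial>\<mu>)))"
proof -
  have space_\<tau>: "space \<tau> = \<Theta>"
    using sets_eq_imp_space_eq[OF assms(3)] by (simp add: space_restrict_space)
  have space_\<nu>: "x \<in> space \<nu>" for x
    using sets_eq_imp_space_eq[OF assms(6)] by simp
  interpret bayes_mixture_predictive \<tau> \<mu> \<nu> f g \<pi> \<nu> q h
    using assms(2,4,5,7-13) space_\<tau>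
    by (simp add: bayes_mixture_predictive_def bayes_mixture_predictive_axioms_def
        bayes_mixture_def bayes_mixture_axioms_def prob_density_def)
  show ?thesis
    using X.cond_density_comp_post[OF assms(1) prior K X] X.cond_density_mixing_post[OF assms(1) prior K X]
      X.cond_density_posterior[OF assms(1) prior K X] cond_density_predictive[OF assms(1) prior K X J Y XY]
    by (intro conjI allI impI X.posterior_eq_bind X.posterior_mixture predictive_eq_bind predictive_eq_bind'
        space_\<nu>) (assumption | rule AE_I2 predictive_mixture predictive_mixture' space_\<nu>)+
qed

end
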